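(* Consider the four-color urn model (white, black, green, yellow) with replacement matrix $$R=\begin{pmatrix} sQ & E\\ 0 & P\end{pmatrix},$$ a stochastic matrix with $2\times2$ blocks, where $0<s<1$ and $P,Q$ are irreducible stochastic matrices; $\boldsymbol\pi_Q$ is the stationary distribution (row vector) of $Q$; the eigenvalues of $Q$ are $\lambda$ and $1$ with $|\lambda|<1$, and those of $P$ are $\beta$ and $1$ with $|\beta|<1$. Assume $W_0+B_0>0$. Suppose that $R$ is not diagonalizable and that the repeated eigenvalue of $R$ is zero (so that $\beta=s\lambda=0$, i.e. $\beta=\lambda=0$). Let $\boldsymbol\xi$ be a right eigenvector of $Q$ corresponding to $\lambda=0$. Let $RT=TJ$ be a Jordan decomposition with $T$ non-singular with columns $\boldsymbol t_1=(1,1,0,0)'$, $\boldsymbol t_2=(\boldsymbol\xi',0,0)'$, $\boldsymbol t_3$, $\boldsymbol t_4=(1,1,1,1)'$ and $$J=\begin{pmatrix}s&0&0&0\\0&0&1&0\\0&0&0&0\\0&0&0&1\end{pmatrix}$$ (so $R\boldsymbol t_3=\boldsymbol t_2$). Then $$\boldsymbol C_n\boldsymbol t_3/n^{s/2}\Rightarrow N\left(0,\boldsymbol\pi_Q\boldsymbol\xi^2\,U/s\right),$$ where $U$ is the limit (almost surely and in $L^2$) of $(W_n+B_n)/n^s$.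
   Context: Urn model: there are $K$ colors (here $K=4$). $\boldsymbol C_0=(W_0,B_0,G_0,Y_0)$ is a row probability vector (non-negative real coordinates summing to $1$) giving the initial "numbers of balls" of each color, and $R=((r_{ij}))$ is a non-random $K\times K$ stochastic matrix. $\boldsymbol C_n=(W_n,B_n,G_n,Y_n)$ is the row vector of the numbers of balls of each color after the $n$-th trial. At the $n$-th trial a ball is drawn at random, so that, given the past, color $i$ appears with probability $\boldsymbol C_{i,n-1}/n$ (the total after $n-1$ trials is $n$); if color $i$ appears, then for every $j$ the number of balls of color $j$ is increased by $r_{ij}$. Notation: $'$ denotes transpose. For a vector $\boldsymbol\xi$, $\boldsymbol\xi^2$ is the vector of squared coordinates. $\Rightarrow$ denotes convergence in distribution. For a non-negative random variable $U$ and a constant $c\ge0$, $N(0,cU)$ denotes the variance mixture of normals, i.e. the law of $\sqrt{cU}\,Z$ with $Z$ standard normal independent of $U$. *)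

theory Defs
  imports
    "HOL-Probability.Probability"
    "HOL-Computational_Algebra.Polynomial"
begin

section \<open>Matrices\<close>

definition prob_vector :: "real ^ 'k \<Rightarrow> bool" where
  "prob_vector v \<longleftrightarrow> (\<forall>i. 0 \<le> v $ i) \<and> (\<Sum>i\<in>UNIV. v $ i) = 1"

definition stochastic :: "real ^ 'k ^ 'k \<Rightarrow> bool" where
  "stochastic A \<longleftrightarrow> (\<forall>i. prob_vector (row i A))"

definition irreducible_mat :: "real ^ 'k ^ 'k \<Rightarrow> bool" where
  "irreducible_mat A \<longleftrightarrow> (\<forall>i j. \<exists>n. 0 < (((**) A ^^ n) (mat 1)) $ i $ j)"

definition stationary :: "real ^ 'k ^ 'k \<Rightarrow> real ^ 'k \<Rightarrow> bool" where
  "stationary A p \<longleftrightarrow> prob_vector p \<and> p v* A = p"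

definition eigenvector :: "real ^ 'k ^ 'k \<Rightarrow> real \<Rightarrow> real ^ 'k \<Rightarrow> bool" where
  "eigenvector A \<mu> v \<longleftrightarrow> v \<noteq> 0 \<and> A *v v = \<mu> *\<^sub>R v"

definition eigenvalues :: "real ^ 'k ^ 'k \<Rightarrow> real set" where
  "eigenvalues A = {\<mu>. \<exists>v. eigenvector A \<mu> v}"

definition charpoly :: "real ^ 'k ^ 'k \<Rightarrow> real poly" where
  "charpoly A = det (mat [:0, 1:] - map_matrix (\<lambda>a. [:a:]) A)"

definition repeated_eigenvalue :: "real ^ 'k ^ 'k \<Rightarrow> real \<Rightarrow> bool" where
  "repeated_eigenvalue A \<mu> \<longleftrightarrow> 2 \<le> order \<mu> (charpoly A)"

text \<open>
  Diagonalizability is over the reals. The block-triangular matrices considered here have only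
  real eigenvalues, so for them it coincides with diagonalizability over the complex numbers.
\<close>

definition diagonalizable :: "real ^ 'k ^ 'k \<Rightarrow> bool" where
  "diagonalizable A \<longleftrightarrow>
     (\<exists>(S :: real ^ 'k ^ 'k) (D :: real ^ 'k ^ 'k).
       invertible S \<and> (\<forall>i j. i \<noteq> j \<longrightarrow> D $ i $ j = 0) \<and> A ** S = S ** D)"

text \<open>
  In the type \<open>4\<close> the numeral \<open>4\<close> equals \<open>0\<close>; \<open>vector [a, b, c, d]\<close> nevertheless has the
  components \<open>a, b, c, d\<close> at \<open>1, 2, 3, 4\<close>.
\<close>

lemma vector_4:
  fixes a b c d :: "'a :: zero"
  shows "(vector [a, b, c, d] :: 'a ^ 4) $ 1 = a" "(vector [a, b, c, d] :: 'a ^ 4) $ 2 = b"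
    "(vector [a, b, c, d] :: 'a ^ 4) $ 3 = c" "(vector [a, b, c, d] :: 'a ^ 4) $ 4 = d"
  unfolding vector_def by auto

definition block_mat :: "real ^ 2 ^ 2 \<Rightarrow> real ^ 2 ^ 2 \<Rightarrow> real ^ 2 ^ 2 \<Rightarrow> real ^ 2 ^ 2 \<Rightarrow> real ^ 4 ^ 4"
  where
  "block_mat A B C D = vector
     [vector [A $ 1 $ 1, A $ 1 $ 2, B $ 1 $ 1, B $ 1 $ 2],
      vector [A $ 2 $ 1, A $ 2 $ 2, B $ 2 $ 1, B $ 2 $ 2],
      vector [C $ 1 $ 1, C $ 1 $ 2, D $ 1 $ 1, D $ 1 $ 2],
      vector [C $ 2 $ 1, C $ 2 $ 2, D $ 2 $ 1, D $ 2 $ 2]]"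


section \<open>Urn processes\<close>

text \<open>
  \<open>draw n\<close> is the color drawn at the \<open>n\<close>-th trial, \<open>n \<ge> 1\<close> (\<open>draw 0\<close> is irrelevant), and \<open>past n\<close>
  is the information contained in the first \<open>n\<close> trials. Since the initial composition is
  deterministic, \<open>C 1, \<dots>, C n\<close> are functions of the first \<open>n\<close> draws and add no information to it.
\<close>

definition past :: "'a measure \<Rightarrow> (nat \<Rightarrow> 'a \<Rightarrow> 'k) \<Rightarrow> nat \<Rightarrow> 'a measure" where
  "past M draw n = sigma (space M) {draw k -` {i} \<inter> space M | k i. k \<in> {1..n}}"

locale urn_process = prob_space M
  for M :: "'a measure" and R :: "real ^ 'k ^ 'k" and c\<^sub>0 :: "real ^ 'k"
    and draw :: "nat \<Rightarrow> 'a \<Rightarrow> 'k" and C :: "nat \<Rightarrow> 'a \<Rightarrow> real ^ 'k" +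
  assumes stochastic_replacement: "stochastic R"
    and prob_vector_initial: "prob_vector c\<^sub>0"
    and measurable_draw: "\<And>n. 1 \<le> n \<Longrightarrow> draw n \<in> measurable M (count_space UNIV)"
    and initial: "\<And>\<omega>. \<omega> \<in> space M \<Longrightarrow> C 0 \<omega> = c\<^sub>0"
    and replacement: "\<And>n \<omega>. \<omega> \<in> space M \<Longrightarrow> C (Suc n) \<omega> = C n \<omega> + row (draw (Suc n) \<omega>) R"
    and draw_prob: "\<And>n i. AE \<omega> in M.
      real_cond_exp M (past M draw n) (indicator {\<omega> \<in> space M. draw (Suc n) \<omega> = i}) \<omega>
        = C n \<omega> $ i / real (Suc n)"


section \<open>Limits\<close>

definition tendsto_AE_L2 :: "'a measure \<Rightarrow> (nat \<Rightarrow> 'a \<Rightarrow> real) \<Rightarrow> ('a \<Rightarrow> real) \<Rightarrow> bool" where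
  "tendsto_AE_L2 M X U \<longleftrightarrow>
     U \<in> borel_measurable M \<and> integrable M (\<lambda>\<omega>. (U \<omega>)\<^sup>2) \<and>
     (AE \<omega> in M. (\<lambda>n. X n \<omega>) \<longlonglongrightarrow> U \<omega>) \<and>
     (\<lambda>n. \<integral>\<^sup>+ \<omega>. ennreal ((X n \<omega> - U \<omega>)\<^sup>2) \<partial>M) \<longlonglongrightarrow> 0"

text \<open>
  The law \<open>N(0, V)\<close>: on the product space the second coordinate \<open>z\<close> is standard normal and
  independent of \<open>V\<close>. Only meaningful for \<open>V\<close> almost surely non-negative.
\<close>

definition normal_mixture :: "'a measure \<Rightarrow> ('a \<Rightarrow> real) \<Rightarrow> real measure" where
  "normal_mixture M V =
     distr (M \<Otimes>\<^sub>M density lborel std_normal_density) borel (\<lambda>(\<omega>, z). sqrt (V \<omega>) * z)"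

end

theory Submission
  imports Defs "HOL-Computational_Algebra.Nth_Powers" "HOL-Real_Asymp.Real_Asymp"
begin

text \<open>
  Two linear facts reduce the urn to a sum of independent variables observed at a random time.
  First, the eigenvalue \<open>0\<close> makes the stochastic \<open>2 \<times> 2\<close> matrix \<open>Q\<close> singular, so both rows of \<open>Q\<close>
  equal \<open>\<pi>\<^sub>Q\<close> (\<open>stochastic_singular_2x2_rows_stationary\<close>). Hence every white or black draw adds
  \<open>s \<pi>\<^sub>Q\<close> to the white and black contents and any other draw adds nothing to them: both are
  deterministic functions of the number \<open>N n\<close> of white or black draws among the first \<open>n\<close>.
  Secondly, \<open>R t\<^sub>3 = t\<^sub>2\<close> is supported on white and black, so \<open>C n \<bullet> t\<^sub>3\<close> is a constant plus the sum of
  the values \<open>\<xi>\<close> of the white or black draws. The \<open>j\<close>-th such draw has a distribution that depends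
  on \<open>j\<close> only and tends to \<open>\<pi>\<^sub>Q\<close>, under which \<open>\<xi>\<close> has mean \<open>0\<close> and variance \<open>\<pi>\<^sub>Q \<xi>\<^sup>2\<close>.

  Therefore the characteristic function of this sum at \<open>u\<close> is the expectation of a product
  \<open>sum_char z u (N n)\<close> of \<open>N n\<close> deterministic factors (\<open>expectation_cis_sum\<close>). At \<open>u = t / n powr (s / 2)\<close>
  the product is close to \<open>exp (- \<pi>\<^sub>Q \<xi>\<^sup>2 u\<^sup>2 N n / 2)\<close> (\<open>sum_char_gaussian_limit\<close>), and since
  \<open>N n / n powr s\<close> tends to \<open>U / s\<close> almost surely, dominated convergence gives the limit
  \<open>E exp (- t\<^sup>2 \<pi>\<^sub>Q \<xi>\<^sup>2 U / (2 s))\<close>. This is the characteristic function of the normal mixture, and Levy's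
  continuity theorem concludes (\<open>weak_conv_normal_mixture\<close>).

  The limit \<open>U\<close> exists because the white and black mass, divided by
  \<open>\<Prod>k\<le>n. 1 + s / k \<sim> n powr s / \<Gamma>(1 + s)\<close>, is an \<open>L\<^sup>2\<close>-bounded martingale. An explicit rate for its
  \<open>L\<^sup>2\<close> increments (\<open>scaled_mass_diff_bound\<close>) gives almost sure convergence along a sparse subsequence,
  and monotonicity of the mass fills the gaps (\<open>monotone_power_subsequence_limit\<close>).

  The urn is treated for an arbitrary finite set of colours that contains a block \<open>A\<close> with equal rows.
\<close>

section \<open>The law of the sequence of draws\<close>

context urn_process
begin

text \<open>
  All random quantities of the urn are functions of the list of draws so far. This list takes finitely
  many values, so every function of it is integrable and expectations are finite sums.
\<close>
definition history :: "nat \<Rightarrow> 'a \<Rightarrow> 'k list" where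
  "history n \<omega> = map (\<lambda>k. draw k \<omega>) [1..<Suc n]"

definition composition :: "'k list \<Rightarrow> real ^ 'k" where
  "composition xs = c\<^sub>0 + (\<Sum>i\<leftarrow>xs. row i R)"

lemma length_history [simp]: "length (history n \<omega>) = n"
  by (simp add: history_def)

lemma history_0 [simp]: "history 0 \<omega> = []"
  by (simp add: history_def)

lemma history_Suc [simp]: "history (Suc n) \<omega> = history n \<omega> @ [draw (Suc n) \<omega>]"
  by (simp add: history_def)

lemma take_history: "k \<le> n \<Longrightarrow> take k (history n \<omega>) = history k \<omega>"
  by (simp add: history_def take_map del: upt_Suc)

lemma composition_Nil [simp]: "composition [] = c\<^sub>0"
  by (simp add: composition_def)

lemma composition_snoc [simp]: "composition (xs @ [i]) = composition xs + row i R"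
  by (simp add: composition_def)

lemma C_eq_composition: "\<omega> \<in> space M \<Longrightarrow> C n \<omega> = composition (history n \<omega>)"
  by (induction n) (simp_all add: initial replacement)

lemma sum_composition: "(\<Sum>i\<in>UNIV. composition xs $ i) = real (Suc (length xs))"
proof (induction xs rule: rev_induct)
  case Nil
  then show ?case using prob_vector_initial by (simp add: prob_vector_def)
next
  case (snoc i xs)
  have "(\<Sum>j\<in>UNIV. row i R $ j) = 1"
    using stochastic_replacement by (simp add: stochastic_def prob_vector_def)
  then show ?case using snoc by (simp add: sum.distrib)
qed

lemma finite_lists_length: "finite {xs :: 'k list. length xs = n}"
  using finite_lists_length_eq[of "UNIV :: 'k set" n] by simp

lemma space_past [simp]: "space (past M draw n) = space M"
  unfolding past_def by (rule space_measure_of) auto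

lemma subalgebra_past: "subalgebra M (past M draw n)"
proof -
  have "{draw k -` {i} \<inter> space M | k i. k \<in> {1..n}} \<subseteq> sets M"
    using measurable_sets[OF measurable_draw] by auto
  then have "sigma_sets (space M) {draw k -` {i} \<inter> space M | k i. k \<in> {1..n}} \<subseteq> sets M"
    by (rule sets.sigma_sets_subset)
  moreover have "sets (past M draw n) = sigma_sets (space M) {draw k -` {i} \<inter> space M | k i. k \<in> {1..n}}"
    unfolding past_def by (rule sets_measure_of) auto
  ultimately show ?thesis by (simp add: subalgebra_def)
qed

text \<open>
  Measurability with respect to the past is what allows an event of this form to be used as a test set
  for the conditional probability of the next draw.
\<close>
lemma history_event_past:
  "k \<le> n \<Longrightarrow> {\<omega> \<in> space M. history k \<omega> = xs} \<in> sets (past M draw n)"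
proof (induction k arbitrary: xs)
  case 0
  have "{\<omega> \<in> space M. [] = xs} = (if xs = [] then space (past M draw n) else {})" by auto
  then show ?case by (simp only: history_0) (auto simp del: space_past)
next
  case (Suc k)
  show ?case
  proof (cases xs rule: rev_cases)
    case Nil
    then show ?thesis by simp
  next
    case (snoc ys i)
    have "draw (Suc k) -` {i} \<inter> space M \<in> {draw k -` {i} \<inter> space M | k i. k \<in> {1..n}}"
      using Suc.prems by (intro CollectI exI[of _ "Suc k"] exI[of _ i]) simp
    then have "draw (Suc k) -` {i} \<inter> space M \<in> sets (past M draw n)"
      unfolding past_def by (intro in_measure_of) auto
    moreover have "{\<omega> \<in> space M. history (Suc k) \<omega> = xs} =
        {\<omega> \<in> space M. history k \<omega> = ys} \<inter> (draw (Suc k) -` {i} \<inter> space M)"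
      by (auto simp: snoc)
    ultimately show ?thesis using sets.Int[OF Suc.IH[OF Suc_leD[OF Suc.prems]]] by simp
  qed
qed

lemma history_event [measurable]: "{\<omega> \<in> space M. history n \<omega> = xs} \<in> sets M"
  using history_event_past[of n n xs] subalgebra_past[of n] by (auto simp: subalgebra_def)

text \<open>
  The whole law of the urn: on the event that the first \<open>n\<close> draws are \<open>xs\<close> the composition is a constant,
  so integrating the conditional probability of the next draw over it amounts to a multiplication.
\<close>
lemma prob_history_snoc:
  "prob {\<omega> \<in> space M. history (Suc n) \<omega> = xs @ [i]} =
     composition xs $ i / real (Suc n) * prob {\<omega> \<in> space M. history n \<omega> = xs}"
proof -
  interpret sub: sigma_finite_subalgebra M "past M draw n"
    by (rule finite_measure_subalgebra_is_sigma_finite)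
      (intro finite_measure_subalgebra.intro finite_measure_subalgebra_axioms.intro
        finite_measure_axioms subalgebra_past)
  let ?A = "{\<omega> \<in> space M. history n \<omega> = xs}" and ?D = "{\<omega> \<in> space M. draw (Suc n) \<omega> = i}"
  have D: "?D \<in> sets M"
    using measurable_sets[OF measurable_draw, of "Suc n" "{i}"] by (simp add: vimage_def Int_def conj_commute)
  have "prob {\<omega> \<in> space M. history (Suc n) \<omega> = xs @ [i]} = prob (?A \<inter> ?D)"
    by (rule arg_cong[where f = prob]) auto
  also have "\<dots> = (\<integral>\<omega>\<in>?A. indicator ?D \<omega> \<partial>M)"
    using D by (simp add: set_lebesgue_integral_def indicator_inter_arith[symmetric])
  also have "\<dots> = (\<integral>\<omega>\<in>?A. real_cond_exp M (past M draw n) (indicator ?D) \<omega> \<partial>M)"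
    by (rule sub.real_cond_exp_intA)
      (use D in \<open>auto simp: history_event_past intro!: integrable_real_indicator simp: emeasure_eq_measure\<close>)
  also have "\<dots> = (\<integral>\<omega>\<in>?A. composition xs $ i / real (Suc n) \<partial>M)"
    unfolding set_lebesgue_integral_def
  proof (rule integral_cong_AE)
    have "AE \<omega> in M. \<omega> \<in> space M" by simp
    then show "AE \<omega> in M. indicator ?A \<omega> *\<^sub>R real_cond_exp M (past M draw n) (indicator ?D) \<omega> =
        indicator ?A \<omega> *\<^sub>R (composition xs $ i / real (Suc n))"
      using draw_prob[of n i] by eventually_elim (auto simp: indicator_def C_eq_composition)
  qed measurable
  also have "\<dots> = composition xs $ i / real (Suc n) * prob ?A"
    by (simp add: set_lebesgue_integral_def)
  finally show ?thesis .
qed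

lemma expectation_history:
  fixes G :: "'k list \<Rightarrow> 'b :: {banach, second_countable_topology}"
  shows "integrable M (\<lambda>\<omega>. G (history n \<omega>))" (is ?int)
    and "(\<integral>\<omega>. G (history n \<omega>) \<partial>M) =
      (\<Sum>xs | length xs = n. prob {\<omega> \<in> space M. history n \<omega> = xs} *\<^sub>R G xs)" (is ?eq)
proof -
  let ?A = "\<lambda>xs. {\<omega> \<in> space M. history n \<omega> = xs}"
  have eq: "G (history n \<omega>) = (\<Sum>xs | length xs = n. indicator (?A xs) \<omega> *\<^sub>R G xs)"
    if "\<omega> \<in> space M" for \<omega>
  proof -
    have "(\<Sum>xs | length xs = n. indicator (?A xs) \<omega> *\<^sub>R G xs) =
        (\<Sum>xs | length xs = n. if history n \<omega> = xs then G xs else 0)"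
      using that by (intro sum.cong) auto
    then show ?thesis using finite_lists_length[of n] by simp
  qed
  have *: "integrable M (\<lambda>\<omega>. indicator (?A xs) \<omega> *\<^sub>R G xs)" for xs
    by (rule integrable_indicator) (simp_all add: emeasure_eq_measure)
  show ?int
    by (subst Bochner_Integration.integrable_cong[OF refl eq]) (auto intro!: *)
  have "(\<integral>\<omega>. G (history n \<omega>) \<partial>M) =
      (\<integral>\<omega>. (\<Sum>xs | length xs = n. indicator (?A xs) \<omega> *\<^sub>R G xs) \<partial>M)"
    by (rule Bochner_Integration.integral_cong[OF refl eq])
  also have "\<dots> = (\<Sum>xs | length xs = n. \<integral>\<omega>. indicator (?A xs) \<omega> *\<^sub>R G xs \<partial>M)"
    by (rule Bochner_Integration.integral_sum) (rule *)
  also have "\<dots> = (\<Sum>xs | length xs = n. prob (?A xs) *\<^sub>R G xs)"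
    by (intro sum.cong refl has_bochner_integral_integral_eq has_bochner_integral_indicator)
      (simp_all add: emeasure_eq_measure)
  finally show ?eq .
qed

text \<open>
  One step of the urn in the form in which it is used from now on; it replaces the conditional
  expectation given the past.
\<close>
lemma expectation_history_Suc:
  fixes G :: "'k list \<Rightarrow> 'b :: {banach, second_countable_topology}"
  shows "(\<integral>\<omega>. G (history (Suc n) \<omega>) \<partial>M) =
    (\<integral>\<omega>. (\<Sum>i\<in>UNIV. (composition (history n \<omega>) $ i / real (Suc n)) *\<^sub>R G (history n \<omega> @ [i])) \<partial>M)"
proof -
  have bij: "bij_betw (\<lambda>(xs, i). xs @ [i]) ({xs :: 'k list. length xs = n} \<times> UNIV) {xs. length xs = Suc n}"
    by (rule bij_betwI[where g = "\<lambda>xs. (butlast xs, last xs)"])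
      (auto intro!: append_butlast_last_id)
  have "(\<integral>\<omega>. G (history (Suc n) \<omega>) \<partial>M) =
    (\<Sum>(xs, i) \<in> {xs. length xs = n} \<times> UNIV.
       prob {\<omega> \<in> space M. history (Suc n) \<omega> = xs @ [i]} *\<^sub>R G (xs @ [i]))"
    by (subst expectation_history(2), subst sum.reindex_bij_betw[OF bij, symmetric])
      (simp add: case_prod_unfold)
  also have "\<dots> = (\<Sum>xs | length xs = n. prob {\<omega> \<in> space M. history n \<omega> = xs} *\<^sub>R
      (\<Sum>i\<in>UNIV. (composition xs $ i / real (Suc n)) *\<^sub>R G (xs @ [i])))"
    unfolding prob_history_snoc
    by (subst sum.cartesian_product[symmetric]) (simp add: scaleR_sum_right mult.commute)
  also have "\<dots> = (\<integral>\<omega>. (\<Sum>i\<in>UNIV. (composition (history n \<omega>) $ i / real (Suc n)) *\<^sub>R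
      G (history n \<omega> @ [i])) \<partial>M)"
    by (rule expectation_history(2)[symmetric])
  finally show ?thesis .
qed

end

section \<open>Normalization of the mass of a block\<close>

text \<open>
  This equals \<open>\<Prod>k=1..n. 1 + s / k\<close>, the factor by which the mean mass of the block grows in \<open>n\<close> trials.
\<close>
definition growth :: "real \<Rightarrow> nat \<Rightarrow> real" where
  "growth s n = pochhammer (1 + s) n / fact n"

lemma growth_0 [simp]: "growth s 0 = 1"
  by (simp add: growth_def)

lemma growth_Suc: "growth s (Suc n) = growth s n * (1 + s / real (Suc n))"
proof -
  have "pochhammer (1 + s) (Suc n) = pochhammer (1 + s) n * (real (Suc n) + s)"
    by (simp add: pochhammer_rec' algebra_simps)
  then show ?thesis by (simp add: growth_def field_simps del: of_nat_Suc)
qed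

lemma growth_pos: "0 < s \<Longrightarrow> 0 < growth s n"
  by (simp add: growth_def pochhammer_pos)

text \<open>
  Up to the factor \<open>s\<close>, the quotient is the reciprocal of Euler's product for the Gamma function.
\<close>
lemma growth_asymptotics:
  assumes "0 < s"
  shows "(\<lambda>n. growth s n / real n powr s) \<longlonglongrightarrow> 1 / (s * Gamma s)"
proof -
  have "(\<lambda>n. 1 / (s * Gamma_series s n)) \<longlonglongrightarrow> 1 / (s * Gamma s)"
    using assms Gamma_real_pos[of s] by (intro tendsto_intros Gamma_series_LIMSEQ) (auto simp del: Gamma_real_pos)
  moreover have "\<forall>\<^sub>F n in sequentially. 1 / (s * Gamma_series s n) = growth s n / real n powr s"
    using eventually_gt_at_top[of 0]
  proof eventually_elim
    case (elim n)
    have "pochhammer s (Suc n) = s * pochhammer (1 + s) n"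
      by (simp add: pochhammer_rec add.commute)
    then show ?case using assms elim
      by (simp add: Gamma_series_def growth_def powr_def)
  qed
  ultimately show ?thesis by (rule Lim_transform_eventually)
qed

section \<open>A block of colours of rank one\<close>

text \<open>
  Each draw from \<open>A\<close> adds the same vector \<open>s \<nu>\<close> to the contents of the block \<open>A\<close>, and a draw from outside
  adds nothing there. The contents of the block are then functions of the number of hits of \<open>A\<close>.
\<close>
locale rank_one_block_urn = urn_process M R c\<^sub>0 draw C
  for M :: "'a measure" and R :: "real ^ 'k ^ 'k" and c\<^sub>0 :: "real ^ 'k"
    and draw :: "nat \<Rightarrow> 'a \<Rightarrow> 'k" and C :: "nat \<Rightarrow> 'a \<Rightarrow> real ^ 'k" +
  fixes A :: "'k set" and s :: real and \<nu> :: "'k \<Rightarrow> real"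
  assumes s_pos: "0 < s"
    and block_rows: "\<And>i j. i \<in> A \<Longrightarrow> j \<in> A \<Longrightarrow> R $ i $ j = s * \<nu> j"
    and off_block_rows: "\<And>i j. i \<notin> A \<Longrightarrow> j \<in> A \<Longrightarrow> R $ i $ j = 0"
    and \<nu>_nonneg: "\<And>j. j \<in> A \<Longrightarrow> 0 \<le> \<nu> j"
    and sum_\<nu>: "sum \<nu> A = 1"
    and initial_mass_pos: "0 < (\<Sum>i\<in>A. c\<^sub>0 $ i)"
begin

definition hits :: "'k list \<Rightarrow> nat" where
  "hits xs = length (filter (\<lambda>i. i \<in> A) xs)"

abbreviation N :: "nat \<Rightarrow> 'a \<Rightarrow> nat" where
  "N n \<omega> \<equiv> hits (history n \<omega>)"

abbreviation x\<^sub>0 :: real where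
  "x\<^sub>0 \<equiv> \<Sum>i\<in>A. c\<^sub>0 $ i"

definition mass :: "nat \<Rightarrow> real" where
  "mass m = x\<^sub>0 + s * real m"

lemma hits_Nil [simp]: "hits [] = 0"
  and hits_snoc [simp]: "hits (xs @ [i]) = (if i \<in> A then Suc (hits xs) else hits xs)"
  by (auto simp: hits_def)

lemma hits_le_length: "hits xs \<le> length xs"
  by (simp add: hits_def)

lemma N_le: "N n \<omega> \<le> n"
  using hits_le_length[of "history n \<omega>"] by simp

lemma mass_pos: "0 < mass m"
  unfolding mass_def using initial_mass_pos s_pos by (intro add_pos_nonneg) auto

lemma mass_Suc: "mass (Suc m) = mass m + s"
  by (simp add: mass_def algebra_simps)

lemma composition_in_block:
  "j \<in> A \<Longrightarrow> composition xs $ j = c\<^sub>0 $ j + s * \<nu> j * real (hits xs)"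
  by (induction xs rule: rev_induct)
    (auto simp: row_def block_rows off_block_rows algebra_simps)

lemma sum_colour_weights: "(\<Sum>i\<in>A. c\<^sub>0 $ i + s * \<nu> i * real m) = mass m"
proof -
  have "(\<Sum>i\<in>A. c\<^sub>0 $ i + s * \<nu> i * real m) = x\<^sub>0 + s * real m * sum \<nu> A"
    unfolding sum_distrib_left by (simp add: sum.distrib mult_ac)
  then show ?thesis by (simp add: sum_\<nu> mass_def)
qed

lemma sum_composition_block: "(\<Sum>j\<in>A. composition xs $ j) = mass (hits xs)"
  using sum_colour_weights[of "hits xs"] by (simp add: composition_in_block)

lemma sum_composition_off_block:
  "(\<Sum>j\<in>-A. composition xs $ j) = real (Suc (length xs)) - mass (hits xs)"
  using sum_composition[of xs] sum.subset_diff[of A UNIV "\<lambda>j. composition xs $ j"]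
  by (simp add: sum_composition_block Compl_eq_Diff_UNIV)

text \<open>
  The number of hits is a Markov chain: it increases by one with probability \<open>mass (N n) / (n + 1)\<close>.
  The function \<open>F\<close> may also depend on the earlier draws.
\<close>
lemma expectation_hits_Suc:
  fixes F :: "'k list \<Rightarrow> nat \<Rightarrow> 'b :: {banach, second_countable_topology}"
  shows "(\<integral>\<omega>. F (history n \<omega>) (N (Suc n) \<omega>) \<partial>M) =
    (\<integral>\<omega>. (mass (N n \<omega>) / real (Suc n)) *\<^sub>R F (history n \<omega>) (Suc (N n \<omega>)) +
       (1 - mass (N n \<omega>) / real (Suc n)) *\<^sub>R F (history n \<omega>) (N n \<omega>) \<partial>M)"
proof -
  have "(\<Sum>i\<in>UNIV. (composition xs $ i / real (Suc n)) *\<^sub>R F xs (hits (xs @ [i]))) =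
      (mass (hits xs) / real (Suc n)) *\<^sub>R F xs (Suc (hits xs)) +
      (1 - mass (hits xs) / real (Suc n)) *\<^sub>R F xs (hits xs)" if "length xs = n" for xs
  proof -
    have "(\<Sum>i\<in>UNIV. (composition xs $ i / real (Suc n)) *\<^sub>R F xs (hits (xs @ [i]))) =
        (\<Sum>i\<in>-A. (composition xs $ i / real (Suc n)) *\<^sub>R F xs (hits xs)) +
        (\<Sum>i\<in>A. (composition xs $ i / real (Suc n)) *\<^sub>R F xs (Suc (hits xs)))"
      by (subst sum.subset_diff[of A UNIV]) (auto simp: Compl_eq_Diff_UNIV intro!: arg_cong2[where f = "(+)"] sum.cong)
    also have "\<dots> = ((\<Sum>i\<in>-A. composition xs $ i) / real (Suc n)) *\<^sub>R F xs (hits xs) +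
        ((\<Sum>i\<in>A. composition xs $ i) / real (Suc n)) *\<^sub>R F xs (Suc (hits xs))"
      by (simp only: scaleR_sum_left[symmetric] sum_divide_distrib)
    finally show ?thesis
      by (simp only: sum_composition_off_block sum_composition_block that diff_divide_distrib)
        (simp add: add.commute)
  qed
  then show ?thesis
    using expectation_history_Suc[of "\<lambda>xs. F (butlast xs) (hits xs)" n] by simp
qed

lemma integrable_N: "integrable M (\<lambda>\<omega>. f (N n \<omega>))"
  for f :: "nat \<Rightarrow> 'b :: {banach, second_countable_topology}"
  by (rule expectation_history(1)[of "\<lambda>xs. f (hits xs)"])

lemma expectation_mass_Suc:
  fixes H :: "'k list \<Rightarrow> real"
  shows "(\<integral>\<omega>. H (history n \<omega>) * mass (N (Suc n) \<omega>) \<partial>M) =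
    (1 + s / real (Suc n)) * (\<integral>\<omega>. H (history n \<omega>) * mass (N n \<omega>) \<partial>M)"
proof -
  have "mass k / real (Suc n) * (H xs * mass (Suc k)) + (1 - mass k / real (Suc n)) * (H xs * mass k)
      = (1 + s / real (Suc n)) * (H xs * mass k)" for xs k
    by (simp add: mass_Suc field_simps del: of_nat_Suc)
  then show ?thesis
    using expectation_hits_Suc[of "\<lambda>xs k. H xs * mass k" n] by simp
qed

section \<open>The martingale of the scaled mass\<close>

definition scaled_mass :: "nat \<Rightarrow> 'a \<Rightarrow> real" where
  "scaled_mass n \<omega> = mass (N n \<omega>) / growth s n"

text \<open>
  Testing against every function \<open>H\<close> of the first \<open>k\<close> draws expresses the martingale property by integrals.
\<close>
lemma scaled_mass_martingale:
  fixes H :: "'k list \<Rightarrow> real"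
  assumes "k \<le> n"
  shows "(\<integral>\<omega>. H (history k \<omega>) * scaled_mass n \<omega> \<partial>M) =
    (\<integral>\<omega>. H (history k \<omega>) * scaled_mass k \<omega> \<partial>M)"
  using assms
proof (induction n rule: dec_induct)
  case (step n)
  have "(\<integral>\<omega>. H (history k \<omega>) * mass (N (Suc n) \<omega>) \<partial>M) =
      (1 + s / real (Suc n)) * (\<integral>\<omega>. H (history k \<omega>) * mass (N n \<omega>) \<partial>M)"
    using expectation_mass_Suc[of "\<lambda>xs. H (take k xs)" n] step by (simp add: take_history del: history_Suc)
  moreover have "1 + s / real (Suc n) \<noteq> 0"
    using s_pos by (smt (verit) divide_nonneg_nonneg of_nat_0_le_iff)
  ultimately show ?case
    using step.IH by (simp add: scaled_mass_def growth_Suc del: history_Suc of_nat_Suc)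
qed simp

lemma expectation_scaled_mass: "(\<integral>\<omega>. scaled_mass n \<omega> \<partial>M) = x\<^sub>0"
  using scaled_mass_martingale[of 0 n "\<lambda>_. 1"] by (simp add: scaled_mass_def mass_def prob_space)

text \<open>
  The squared mass grows in the mean by the factor \<open>1 + 2 s / (n + 1)\<close>, which is at most the square of
  \<open>1 + s / (n + 1)\<close>, plus a multiple of the mean mass. The bound for the latter is arranged as a
  difference of reciprocals of \<open>growth\<close>, so that it telescopes.
\<close>
lemma second_moment_step:
  "(\<integral>\<omega>. (scaled_mass (Suc n) \<omega>)\<^sup>2 \<partial>M) \<le>
     (\<integral>\<omega>. (scaled_mass n \<omega>)\<^sup>2 \<partial>M) + s * x\<^sub>0 * (1 / growth s n - 1 / growth s (Suc n))"
proof -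
  define a where "a = s / real (Suc n)"
  define g where "g = growth s n"
  define e where "e = (\<integral>\<omega>. (scaled_mass n \<omega>)\<^sup>2 \<partial>M)"
  have a: "0 < a" using s_pos by (simp add: a_def)
  have g: "0 < g" using growth_pos[OF s_pos] by (simp add: g_def)
  have g': "growth s (Suc n) = g * (1 + a)" by (simp add: growth_Suc g_def a_def)
  have e: "0 \<le> e" by (simp add: e_def)
  have "mass k / real (Suc n) * (mass (Suc k))\<^sup>2 + (1 - mass k / real (Suc n)) * (mass k)\<^sup>2
      = (1 + 2 * a) * (mass k)\<^sup>2 + s * a * mass k" for k
    by (simp add: mass_Suc a_def field_simps power2_eq_square del: of_nat_Suc)
  then have "(\<integral>\<omega>. (mass (N (Suc n) \<omega>))\<^sup>2 \<partial>M) =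
      (\<integral>\<omega>. (1 + 2 * a) * (mass (N n \<omega>))\<^sup>2 + s * a * mass (N n \<omega>) \<partial>M)"
    using expectation_hits_Suc[of "\<lambda>xs k. (mass k)\<^sup>2" n] by simp
  also have "\<dots> = (1 + 2 * a) * (\<integral>\<omega>. (mass (N n \<omega>))\<^sup>2 \<partial>M) + s * a * (\<integral>\<omega>. mass (N n \<omega>) \<partial>M)"
    by (subst Bochner_Integration.integral_add)
      (auto intro!: integrable_mult_right integrable_N[of "\<lambda>k. (mass k)\<^sup>2"] integrable_N[of mass])
  also have "(\<integral>\<omega>. (mass (N n \<omega>))\<^sup>2 \<partial>M) = g\<^sup>2 * e"
    using g by (simp add: e_def scaled_mass_def g_def[symmetric] power_divide)
  also have "(\<integral>\<omega>. mass (N n \<omega>) \<partial>M) = g * x\<^sub>0"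
    using g expectation_scaled_mass[of n] by (simp add: scaled_mass_def g_def[symmetric] field_simps)
  finally have "(\<integral>\<omega>. (scaled_mass (Suc n) \<omega>)\<^sup>2 \<partial>M) =
      ((1 + 2 * a) * (g\<^sup>2 * e) + s * a * (g * x\<^sub>0)) / (g * (1 + a))\<^sup>2"
    by (simp add: scaled_mass_def g' power_divide del: history_Suc)
  also have "\<dots> = (1 + 2 * a) / (1 + a)\<^sup>2 * e + s * x\<^sub>0 / g * (a / (1 + a)) * (1 / (1 + a))"
    using a g by (simp add: divide_simps) (simp add: power2_eq_square algebra_simps)
  also have "\<dots> \<le> 1 * e + s * x\<^sub>0 / g * (a / (1 + a)) * 1"
  proof (intro add_mono mult_right_mono mult_left_mono)
    show "(1 + 2 * a) / (1 + a)\<^sup>2 \<le> 1" using a zero_le_power2[of a] by (simp add: power2_sum divide_le_eq not_less)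
    show "1 / (1 + a) \<le> 1" using a by simp
    show "0 \<le> s * x\<^sub>0 / g * (a / (1 + a))" using a g s_pos initial_mass_pos by simp
  qed (use e in auto)
  also have "\<dots> = e + s * x\<^sub>0 * (1 / g - 1 / (g * (1 + a)))"
    using a g by (simp add: divide_simps)
  finally show ?thesis by (simp add: e_def g' g_def)
qed

text \<open>
  For a martingale the mean square of an increment is the difference of the second moments, and these
  differences telescope. The bound is uniform in \<open>n\<close>.
\<close>
lemma scaled_mass_diff_bound:
  assumes "k \<le> n"
  shows "(\<integral>\<omega>. (scaled_mass n \<omega> - scaled_mass k \<omega>)\<^sup>2 \<partial>M) \<le> s * x\<^sub>0 / growth s k"
proof -
  define e where "e n = (\<integral>\<omega>. (scaled_mass n \<omega>)\<^sup>2 \<partial>M)" for n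
  have e_le: "e n \<le> e k + s * x\<^sub>0 * (1 / growth s k - 1 / growth s n)"
    using assms
  proof (induction n rule: dec_induct)
    case (step n)
    then show ?case using second_moment_step[of n] unfolding e_def by (simp add: algebra_simps)
  qed simp
  let ?f = "\<lambda>n xs. mass (hits xs) / growth s n"
  have int: "integrable M (\<lambda>\<omega>. scaled_mass i \<omega> * scaled_mass j \<omega>)" for i j
  proof -
    have "integrable M (\<lambda>\<omega>. (\<lambda>xs. ?f i (take i xs) * ?f j (take j xs)) (history (max i j) \<omega>))"
      by (rule expectation_history(1))
    then show ?thesis by (simp add: take_history scaled_mass_def)
  qed
  \<comment> \<open>By the martingale property the increment is orthogonal to the earlier value.\<close>
  have cross: "(\<integral>\<omega>. scaled_mass k \<omega> * scaled_mass n \<omega> \<partial>M) = e k"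
    using scaled_mass_martingale[OF assms, of "?f k"]
    by (simp add: scaled_mass_def e_def power2_eq_square)
  have "(\<integral>\<omega>. (scaled_mass n \<omega> - scaled_mass k \<omega>)\<^sup>2 \<partial>M) =
     (\<integral>\<omega>. scaled_mass n \<omega> * scaled_mass n \<omega> + scaled_mass k \<omega> * scaled_mass k \<omega>
         - 2 * (scaled_mass k \<omega> * scaled_mass n \<omega>) \<partial>M)"
    by (simp add: power2_eq_square algebra_simps)
  also have "\<dots> = e n + e k - 2 * e k"
    using int by (subst Bochner_Integration.integral_diff) (auto simp: e_def power2_eq_square cross[unfolded e_def])
  also have "\<dots> \<le> s * x\<^sub>0 * (1 / growth s k - 1 / growth s n)"
    using e_le by simp
  also have "\<dots> \<le> s * x\<^sub>0 * (1 / growth s k)"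
    using s_pos initial_mass_pos growth_pos[OF s_pos, of n] by (intro mult_left_mono) auto
  finally show ?thesis by simp
qed

end

section \<open>Convergence of the mass\<close>

lemma filterlim_power_nat_at_top:
  "0 < p \<Longrightarrow> filterlim (\<lambda>j::nat. j ^ p) sequentially sequentially"
  by (rule filterlim_at_top_mono[OF filterlim_ident])
    (auto intro: eventually_sequentiallyI[of 1] self_le_power)

text \<open>
  Consecutive \<open>p\<close>-th powers have quotient tending to \<open>1\<close>, so for a monotone function the values at
  \<open>p\<close>-th powers control all others up to factors tending to \<open>1\<close>.
\<close>
lemma monotone_power_subsequence_limit:
  fixes f :: "nat \<Rightarrow> real"
  assumes mono: "mono f" and nonneg: "\<And>n. 0 \<le> f n" and "0 < p" "0 < s"
    and lim: "(\<lambda>j. f (j ^ p) / real (j ^ p) powr s) \<longlonglongrightarrow> l"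
  shows "(\<lambda>n. f n / real n powr s) \<longlonglongrightarrow> l"
proof -
  define h where "h j = f (j ^ p) / real (j ^ p) powr s" for j
  define q where "q j = ((real j / real (Suc j)) ^ p) powr s" for j
  define r where "r n = nth_root_nat p n" for n
  have r: "filterlim r sequentially sequentially"
    unfolding filterlim_at_top
  proof
    fix J :: nat
    show "\<forall>\<^sub>F n in sequentially. J \<le> r n"
      using eventually_ge_at_top[of "J ^ p"]
      by eventually_elim (simp add: r_def nth_root_nat_ge \<open>0 < p\<close>)
  qed
  have q: "q \<longlonglongrightarrow> 1"
  proof -
    have "q \<longlonglongrightarrow> (1 ^ p) powr s"
      unfolding q_def by (intro tendsto_powr tendsto_power LIMSEQ_n_over_Suc_n tendsto_const) auto
    then show ?thesis by simp
  qed
  have h: "h \<longlonglongrightarrow> l" using lim by (simp add: h_def[abs_def])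
  have "(\<lambda>j. h j * q j) \<longlonglongrightarrow> l" using tendsto_mult[OF h q] by simp
  from filterlim_compose[OF this r] have lower: "(\<lambda>n. h (r n) * q (r n)) \<longlonglongrightarrow> l" .
  have "(\<lambda>j. h (Suc j) / q j) \<longlonglongrightarrow> l"
    using tendsto_divide[OF LIMSEQ_Suc[OF h] q] by simp
  from filterlim_compose[OF this r] have upper: "(\<lambda>n. h (Suc (r n)) / q (r n)) \<longlonglongrightarrow> l" .
  have "h (r n) * q (r n) \<le> f n / real n powr s \<and> f n / real n powr s \<le> h (Suc (r n)) / q (r n)"
    if "1 \<le> n" for n
  proof -
    \<comment> \<open>The argument lies between two consecutive powers.\<close>
    define j where "j = r n"
    have j1: "1 \<le> j"
      unfolding j_def r_def by (rule nth_root_nat_ge[OF \<open>0 < p\<close>]) (use that in simp)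
    have j2: "j ^ p \<le> n"
      unfolding j_def r_def by (rule nth_root_nat_power_le[OF \<open>0 < p\<close>])
    have j3: "n < Suc j ^ p"
    proof (rule ccontr)
      assume "\<not> n < Suc j ^ p"
      then have "Suc j ^ p \<le> n" by (simp only: not_less)
      from nth_root_nat_ge[OF \<open>0 < p\<close> this] show False by (simp add: j_def r_def)
    qed
    note j = j1 j2 j3
    define a b where "a = real (j ^ p)" and "b = real (Suc j ^ p)"
    have ab: "0 < a" "a \<le> real n" "real n \<le> b" "0 < b"
      using j unfolding a_def b_def of_nat_le_iff of_nat_0_less_iff by auto
    have qj: "q j = a powr s / b powr s"
      using ab by (simp add: q_def a_def b_def power_divide powr_divide)
    have "f (j ^ p) / b powr s \<le> f n / real n powr s"
      using ab j nonneg \<open>0 < s\<close> by (intro frac_le monoD[OF mono] powr_mono2) auto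
    moreover have "f n / real n powr s \<le> f (Suc j ^ p) / a powr s"
      using ab j nonneg \<open>0 < s\<close> by (intro frac_le monoD[OF mono] powr_mono2) auto
    moreover have "h j * q j = f (j ^ p) / b powr s" "h (Suc j) / q j = f (Suc j ^ p) / a powr s"
      using ab unfolding qj h_def a_def[symmetric] b_def[symmetric] by simp_all
    ultimately show ?thesis by (simp add: j_def)
  qed
  then show ?thesis
    by (intro tendsto_sandwich[OF _ _ lower upper]) (auto simp: eventually_sequentially)
qed

text \<open>
  The \<open>L\<^sup>1\<close> norms of the increments are summable, so the increments are almost surely absolutely summable.
\<close>
lemma (in prob_space) AE_convergent_of_summable_L2_increments:
  fixes Y :: "nat \<Rightarrow> 'a \<Rightarrow> real"
  assumes [measurable]: "\<And>j. Y j \<in> borel_measurable M"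
    and int: "\<And>j. integrable M (\<lambda>\<omega>. (Y (Suc j) \<omega> - Y j \<omega>)\<^sup>2)"
    and bound: "\<And>j. (\<integral>\<omega>. (Y (Suc j) \<omega> - Y j \<omega>)\<^sup>2 \<partial>M) \<le> (\<epsilon> j)\<^sup>2"
    and pos: "\<And>j. 0 < \<epsilon> j" and summable: "summable \<epsilon>"
  shows "AE \<omega> in M. convergent (\<lambda>j. Y j \<omega>)"
proof -
  define d where "d j \<omega> = Y (Suc j) \<omega> - Y j \<omega>" for j \<omega>
  have [measurable]: "d j \<in> borel_measurable M" for j
    unfolding d_def by measurable
  have L1: "(\<integral>\<^sup>+\<omega>. ennreal \<bar>d j \<omega>\<bar> \<partial>M) \<le> ennreal (\<epsilon> j)" for j
  proof -
    \<comment> \<open>Arithmetic-geometric mean inequality, weighted so that both terms have mean at most \<open>\<epsilon> j / 2\<close>.\<close>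
    have le: "\<bar>d j \<omega>\<bar> \<le> ((d j \<omega>)\<^sup>2 / \<epsilon> j + \<epsilon> j) / 2" for \<omega>
    proof -
      have "0 \<le> (\<bar>d j \<omega>\<bar> - \<epsilon> j)\<^sup>2" by simp
      then have "2 * \<bar>d j \<omega>\<bar> * \<epsilon> j \<le> (d j \<omega>)\<^sup>2 + \<epsilon> j * \<epsilon> j"
        by (simp add: power2_diff) (simp add: power2_eq_square)
      then show ?thesis using pos[of j] by (simp add: field_simps)
    qed
    have "(\<integral>\<^sup>+\<omega>. ennreal \<bar>d j \<omega>\<bar> \<partial>M) \<le> (\<integral>\<^sup>+\<omega>. ennreal (((d j \<omega>)\<^sup>2 / \<epsilon> j + \<epsilon> j) / 2) \<partial>M)"
      using le by (intro nn_integral_mono ennreal_leI)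
    also have "\<dots> = ennreal (\<integral>\<omega>. ((d j \<omega>)\<^sup>2 / \<epsilon> j + \<epsilon> j) / 2 \<partial>M)"
      using int[of j] pos[of j] unfolding d_def
      by (intro nn_integral_eq_integral) (auto intro!: AE_I2 divide_nonneg_pos add_nonneg_nonneg)
    also have "(\<integral>\<omega>. ((d j \<omega>)\<^sup>2 / \<epsilon> j + \<epsilon> j) / 2 \<partial>M) = ((\<integral>\<omega>. (d j \<omega>)\<^sup>2 \<partial>M) / \<epsilon> j + \<epsilon> j) / 2"
      using int[of j] by (simp add: d_def prob_space)
    also have "\<dots> \<le> ((\<epsilon> j)\<^sup>2 / \<epsilon> j + \<epsilon> j) / 2"
      using bound[of j] pos[of j] unfolding d_def by (intro divide_right_mono add_right_mono) auto
    also have "\<dots> = \<epsilon> j" using pos[of j] by (simp add: power2_eq_square)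
    finally show ?thesis by (simp add: ennreal_leI)
  qed
  have "(\<integral>\<^sup>+\<omega>. (\<Sum>j. ennreal \<bar>d j \<omega>\<bar>) \<partial>M) = (\<Sum>j. \<integral>\<^sup>+\<omega>. ennreal \<bar>d j \<omega>\<bar> \<partial>M)"
    by (rule nn_integral_suminf) measurable
  also have "\<dots> \<le> (\<Sum>j. ennreal (\<epsilon> j))"
    by (intro suminf_le L1) auto
  also have "\<dots> < \<infinity>"
    using summable pos by (subst suminf_ennreal2) (auto intro: less_imp_le)
  finally have "AE \<omega> in M. (\<Sum>j. ennreal \<bar>d j \<omega>\<bar>) \<noteq> \<infinity>"
    by (intro nn_integral_PInf_AE) auto
  then show ?thesis
  proof eventually_elim
    case (elim \<omega>)
    then have "summable (\<lambda>j. \<bar>d j \<omega>\<bar>)"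
      by (intro summable_suminf_not_top) auto
    then have "convergent (\<lambda>n. \<Sum>j<n. d j \<omega>)"
      by (simp add: summable_iff_convergent[symmetric] summable_rabs_cancel)
    then have "convergent (\<lambda>n. Y n \<omega> - Y 0 \<omega>)"
      using sum_lessThan_telescope[of "\<lambda>j. Y j \<omega>"] by (simp add: d_def)
    then show ?case by (simp add: convergent_diff_const_right_iff)
  qed
qed

context rank_one_block_urn
begin

lemma measurable_scaled_mass [measurable]: "scaled_mass n \<in> borel_measurable M"
  unfolding scaled_mass_def[abs_def]
  by (rule borel_measurable_integrable) (rule integrable_N[of "\<lambda>k. mass k / growth s n"])

lemma integrable_scaled_mass_diff: "integrable M (\<lambda>\<omega>. (scaled_mass i \<omega> - scaled_mass j \<omega>)\<^sup>2)"
proof -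
  have "integrable M (\<lambda>\<omega>. (\<lambda>xs. (mass (hits (take i xs)) / growth s i -
      mass (hits (take j xs)) / growth s j)\<^sup>2) (history (max i j) \<omega>))"
    by (rule expectation_history(1))
  then show ?thesis by (simp add: take_history scaled_mass_def)
qed

lemma scaled_mass_eq: "scaled_mass n \<omega> * (growth s n / real n powr s) = mass (N n \<omega>) / real n powr s"
  using growth_pos[OF s_pos, of n] by (simp add: scaled_mass_def)

lemma growth_asymptotics_pos: "0 < 1 / (s * Gamma s)"
  using s_pos by (simp add: Gamma_real_pos)

lemma mono_mass_N: "mono (\<lambda>n. mass (N n \<omega>))"
  using s_pos by (intro incseq_SucI) (simp add: mass_def)

text \<open>
  Since \<open>growth s n\<close> has order \<open>n powr s\<close>, the terms are \<open>O(j powr (- p s / 2)) = O(1 / j\<^sup>2)\<close>.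
\<close>
lemma summable_sparse_growth:
  assumes "4 \<le> real p * s" "0 < c"
  shows "summable (\<lambda>j. sqrt (c / growth s (j ^ p)))"
proof -
  obtain l where l: "0 < l" "l < 1 / (s * Gamma s)" using dense[OF growth_asymptotics_pos] by blast
  have "0 < p" using assms(1) by (cases p) auto
  have "\<forall>\<^sub>F n in sequentially. l < growth s n / real n powr s"
    by (rule order_tendstoD(1)[OF growth_asymptotics[OF s_pos] l(2)])
  moreover have "filterlim (\<lambda>j::nat. j ^ p) sequentially sequentially"
    by (rule filterlim_power_nat_at_top[OF \<open>0 < p\<close>])
  ultimately have ev: "\<forall>\<^sub>F j in sequentially. l < growth s (j ^ p) / real (j ^ p) powr s"
    by (rule eventually_compose_filterlim)
  have "\<forall>\<^sub>F j in sequentially. norm (sqrt (c / growth s (j ^ p))) \<le> sqrt (c / l) * inverse (real j ^ 2)"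
    using ev eventually_ge_at_top[of 1]
  proof eventually_elim
    case (elim j)
    have "real j ^ 4 = real j powr 4" using elim by (simp add: powr_numeral)
    also have "\<dots> \<le> real j powr (real p * s)" using elim assms by (intro powr_mono) auto
    also have "\<dots> = real (j ^ p) powr s" using elim by (simp add: powr_powr[symmetric] powr_realpow)
    finally have "l * real j ^ 4 \<le> l * real (j ^ p) powr s" using l by (intro mult_left_mono) auto
    also have "\<dots> \<le> growth s (j ^ p)" using elim by (simp add: field_simps)
    finally have "c / growth s (j ^ p) \<le> c / (l * real j ^ 4)"
      using assms l elim by (intro divide_left_mono mult_pos_pos growth_pos s_pos) auto
    then have "sqrt (c / growth s (j ^ p)) \<le> sqrt (c / (l * real j ^ 4))" by simp
    also have "\<dots> = sqrt (c / l) / sqrt (real j ^ 4)"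
      by (simp add: real_sqrt_divide real_sqrt_mult)
    also have "sqrt (real j ^ 4) = real j ^ 2"
      by (rule real_sqrt_unique) simp_all
    also have "sqrt (c / l) / real j ^ 2 = sqrt (c / l) * inverse (real j ^ 2)"
      by (simp add: divide_inverse)
    finally show ?case using assms growth_pos[OF s_pos, of "j ^ p"] by simp
  qed
  moreover have "summable (\<lambda>j. sqrt (c / l) * inverse (real j ^ 2))"
    by (intro summable_mult inverse_power_summable) simp
  ultimately show ?thesis by (rule summable_comparison_test_ev)
qed

text \<open>
  The scaled mass converges along \<open>j ^ p\<close> for large \<open>p\<close> because of the summable increments. It is not
  monotone itself; the interpolation is applied to the mass, which is, and the factor \<open>growth\<close> is
  then restored.
\<close>
lemma AE_mass_converges:
  obtains Z where "Z \<in> borel_measurable M" "AE \<omega> in M. (\<lambda>n. scaled_mass n \<omega>) \<longlonglongrightarrow> Z \<omega>"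
proof -
  define p where "p = nat \<lceil>4 / s\<rceil>"
  have "4 / s \<le> real p" unfolding p_def by linarith
  then have p: "4 \<le> real p * s" using s_pos by (simp add: field_simps)
  then have "0 < p" by (cases p) auto
  define Y where "Y j = scaled_mass (j ^ p)" for j
  define \<epsilon> where "\<epsilon> j = sqrt (s * x\<^sub>0 / growth s (j ^ p))" for j
  define Z where "Z \<omega> = lim (\<lambda>j. Y j \<omega>)" for \<omega>
  have [measurable]: "Y j \<in> borel_measurable M" for j by (simp add: Y_def)
  have pos: "0 < s * x\<^sub>0" using s_pos initial_mass_pos by simp
  have "AE \<omega> in M. convergent (\<lambda>j. Y j \<omega>)"
  proof (rule AE_convergent_of_summable_L2_increments[where \<epsilon> = \<epsilon>])
    fix j
    have le: "j ^ p \<le> Suc j ^ p" by (intro power_mono) auto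
    show "integrable M (\<lambda>\<omega>. (Y (Suc j) \<omega> - Y j \<omega>)\<^sup>2)"
      unfolding Y_def by (rule integrable_scaled_mass_diff)
    show "0 < \<epsilon> j" using pos growth_pos[OF s_pos] by (simp add: \<epsilon>_def)
    show "(\<integral>\<omega>. (Y (Suc j) \<omega> - Y j \<omega>)\<^sup>2 \<partial>M) \<le> (\<epsilon> j)\<^sup>2"
      using scaled_mass_diff_bound[OF le] pos growth_pos[OF s_pos, of "j ^ p"]
      by (simp add: \<epsilon>_def Y_def del: power_Suc)
    show "summable \<epsilon>" unfolding \<epsilon>_def[abs_def] by (rule summable_sparse_growth[OF p pos])
  qed simp
  then have "AE \<omega> in M. (\<lambda>n. scaled_mass n \<omega>) \<longlonglongrightarrow> Z \<omega>"
  proof eventually_elim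
    case (elim \<omega>)
    let ?l = "1 / (s * Gamma s)"
    have l: "?l \<noteq> 0" using growth_asymptotics_pos by linarith
    have "(\<lambda>j. Y j \<omega>) \<longlonglongrightarrow> Z \<omega>" using elim by (simp add: Z_def convergent_LIMSEQ_iff)
    moreover have "(\<lambda>j. growth s (j ^ p) / real (j ^ p) powr s) \<longlonglongrightarrow> ?l"
      by (rule filterlim_compose[OF growth_asymptotics[OF s_pos]])
        (rule filterlim_power_nat_at_top[OF \<open>0 < p\<close>])
    ultimately have "(\<lambda>j. mass (N (j ^ p) \<omega>) / real (j ^ p) powr s) \<longlonglongrightarrow> Z \<omega> * ?l"
      unfolding scaled_mass_eq[symmetric] Y_def by (rule tendsto_mult)
    then have "(\<lambda>n. mass (N n \<omega>) / real n powr s) \<longlonglongrightarrow> Z \<omega> * ?l"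
      by (intro monotone_power_subsequence_limit[OF mono_mass_N _ \<open>0 < p\<close> s_pos] less_imp_le[OF mass_pos])
    from tendsto_divide[OF this growth_asymptotics[OF s_pos] l]
    have "(\<lambda>n. mass (N n \<omega>) / real n powr s / (growth s n / real n powr s)) \<longlonglongrightarrow> Z \<omega>"
      using l by simp
    moreover have "\<forall>\<^sub>F n in sequentially. mass (N n \<omega>) / real n powr s / (growth s n / real n powr s) = scaled_mass n \<omega>"
      using eventually_gt_at_top[of 0] by eventually_elim (simp add: scaled_mass_def)
    ultimately show ?case by (rule Lim_transform_eventually)
  qed
  moreover have "Z \<in> borel_measurable M" unfolding Z_def[abs_def] by measurable
  ultimately show ?thesis by (rule that[rotated])
qed

text \<open>
  Fatou's lemma transfers the uniform bound on the increments to the limit.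
\<close>
lemma scaled_mass_L2_bound:
  assumes [measurable]: "Z \<in> borel_measurable M"
    and lim: "AE \<omega> in M. (\<lambda>n. scaled_mass n \<omega>) \<longlonglongrightarrow> Z \<omega>"
  shows "(\<integral>\<^sup>+\<omega>. ennreal ((scaled_mass k \<omega> - Z \<omega>)\<^sup>2) \<partial>M) \<le> ennreal (s * x\<^sub>0 / growth s k)"
proof -
  have "(\<integral>\<^sup>+\<omega>. ennreal ((scaled_mass k \<omega> - Z \<omega>)\<^sup>2) \<partial>M) =
      (\<integral>\<^sup>+\<omega>. liminf (\<lambda>n. ennreal ((scaled_mass n \<omega> - scaled_mass k \<omega>)\<^sup>2)) \<partial>M)"
  proof (rule nn_integral_cong_AE)
    show "AE \<omega> in M. ennreal ((scaled_mass k \<omega> - Z \<omega>)\<^sup>2) =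
        liminf (\<lambda>n. ennreal ((scaled_mass n \<omega> - scaled_mass k \<omega>)\<^sup>2))"
      using lim
    proof eventually_elim
      case (elim \<omega>)
      then have "(\<lambda>n. ennreal ((scaled_mass n \<omega> - scaled_mass k \<omega>)\<^sup>2)) \<longlonglongrightarrow>
          ennreal ((Z \<omega> - scaled_mass k \<omega>)\<^sup>2)"
        by (intro tendsto_intros)
      then show ?case
        using lim_imp_Liminf[OF trivial_limit_sequentially] power2_commute[of "Z \<omega>" "scaled_mass k \<omega>"]
        by metis
    qed
  qed
  also have "\<dots> \<le> liminf (\<lambda>n. \<integral>\<^sup>+\<omega>. ennreal ((scaled_mass n \<omega> - scaled_mass k \<omega>)\<^sup>2) \<partial>M)"
    by (rule nn_integral_liminf) measurable
  also have "\<dots> \<le> ennreal (s * x\<^sub>0 / growth s k)"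
  proof (rule Liminf_le)
    show "\<forall>\<^sub>F n in sequentially. (\<integral>\<^sup>+\<omega>. ennreal ((scaled_mass n \<omega> - scaled_mass k \<omega>)\<^sup>2) \<partial>M)
        \<le> ennreal (s * x\<^sub>0 / growth s k)"
      using eventually_ge_at_top[of k]
      by eventually_elim
        (simp add: nn_integral_eq_integral integrable_scaled_mass_diff scaled_mass_diff_bound ennreal_leI)
  qed simp
  finally show ?thesis .
qed

lemma mass_eq_sum_C: "\<omega> \<in> space M \<Longrightarrow> (\<Sum>i\<in>A. C n \<omega> $ i) = mass (N n \<omega>)"
  by (simp add: C_eq_composition sum_composition_block)

text \<open>
  The two normalizations \<open>growth s n\<close> and \<open>n powr s\<close> differ by a convergent deterministic factor \<open>r n\<close>,
  hence the error splits into \<open>r n * (scaled_mass n - Z)\<close> and \<open>(r n - l) * Z\<close>.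
\<close>
lemma mass_tendsto_AE_L2:
  "\<exists>U. tendsto_AE_L2 M (\<lambda>n \<omega>. (\<Sum>i\<in>A. C n \<omega> $ i) / real n powr s) U"
proof -
  obtain Z where Z [measurable]: "Z \<in> borel_measurable M"
    and lim: "AE \<omega> in M. (\<lambda>n. scaled_mass n \<omega>) \<longlonglongrightarrow> Z \<omega>"
    by (rule AE_mass_converges)
  define l where "l = 1 / (s * Gamma s)"
  define r where "r n = growth s n / real n powr s" for n
  have l: "0 < l" unfolding l_def by (rule growth_asymptotics_pos)
  have r: "r \<longlonglongrightarrow> l" unfolding r_def[abs_def] l_def by (rule growth_asymptotics[OF s_pos])
  have AE: "AE \<omega> in M. (\<lambda>n. (\<Sum>i\<in>A. C n \<omega> $ i) / real n powr s) \<longlonglongrightarrow> l * Z \<omega>"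
    using lim AE_space
  proof eventually_elim
    case (elim \<omega>)
    have "(\<lambda>n. scaled_mass n \<omega> * r n) \<longlonglongrightarrow> Z \<omega> * l" using elim(1) r by (rule tendsto_mult)
    then show ?case
      using elim(2) unfolding r_def scaled_mass_eq by (simp add: mass_eq_sum_C mult.commute)
  qed
  have sq: "(x + y)\<^sup>2 \<le> 2 * x\<^sup>2 + 2 * y\<^sup>2" for x y :: real
    using sum_squares_bound[of x y] by (simp add: power2_sum)
  have [measurable]: "integrable M (\<lambda>\<omega>. (scaled_mass 0 \<omega> - Z \<omega>)\<^sup>2)"
    using scaled_mass_L2_bound[OF Z lim, of 0]
    by (intro integrableI_bounded) (auto simp: less_top[symmetric] top_unique)
  have Z2: "integrable M (\<lambda>\<omega>. (Z \<omega>)\<^sup>2)"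
  proof (rule Bochner_Integration.integrable_bound)
    show "integrable M (\<lambda>\<omega>. 2 * (scaled_mass 0 \<omega> - Z \<omega>)\<^sup>2 + 2 * x\<^sub>0\<^sup>2)"
      by (intro Bochner_Integration.integrable_add integrable_mult_right) (fact | simp)+
    show "AE \<omega> in M. norm ((Z \<omega>)\<^sup>2) \<le> norm (2 * (scaled_mass 0 \<omega> - Z \<omega>)\<^sup>2 + 2 * x\<^sub>0\<^sup>2)"
      using sq[of "Z _ - x\<^sub>0" x\<^sub>0]
      by (intro AE_I2) (simp add: scaled_mass_def mass_def power2_commute)
  qed measurable
  have ennreal_lincomb: "ennreal a * ennreal x + ennreal b * ennreal y = ennreal (a * x + b * y)"
    if "0 \<le> a" "0 \<le> x" "0 \<le> b" "0 \<le> y" for a x b y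
    using that by (simp add: ennreal_mult)
  define B where "B = (\<integral>\<omega>. (Z \<omega>)\<^sup>2 \<partial>M)"
  have bound: "(\<integral>\<^sup>+\<omega>. ennreal (((\<Sum>i\<in>A. C n \<omega> $ i) / real n powr s - l * Z \<omega>)\<^sup>2) \<partial>M) \<le>
      ennreal (2 * (r n)\<^sup>2 * (s * x\<^sub>0 / growth s n) + 2 * (r n - l)\<^sup>2 * B)" for n
  proof -
    have "(\<integral>\<^sup>+\<omega>. ennreal (((\<Sum>i\<in>A. C n \<omega> $ i) / real n powr s - l * Z \<omega>)\<^sup>2) \<partial>M) \<le>
      (\<integral>\<^sup>+\<omega>. ennreal (2 * (r n)\<^sup>2) * ennreal ((scaled_mass n \<omega> - Z \<omega>)\<^sup>2) +
         ennreal (2 * (r n - l)\<^sup>2) * ennreal ((Z \<omega>)\<^sup>2) \<partial>M)"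
    proof (rule nn_integral_mono)
      fix \<omega> assume \<omega>: "\<omega> \<in> space M"
      have "(\<Sum>i\<in>A. C n \<omega> $ i) / real n powr s - l * Z \<omega> =
          r n * (scaled_mass n \<omega> - Z \<omega>) + (r n - l) * Z \<omega>"
        using scaled_mass_eq[of n \<omega>] by (auto simp: mass_eq_sum_C \<omega> r_def algebra_simps)
      then have "((\<Sum>i\<in>A. C n \<omega> $ i) / real n powr s - l * Z \<omega>)\<^sup>2 \<le>
          2 * (r n)\<^sup>2 * (scaled_mass n \<omega> - Z \<omega>)\<^sup>2 + 2 * (r n - l)\<^sup>2 * (Z \<omega>)\<^sup>2"
        using sq[of "r n * (scaled_mass n \<omega> - Z \<omega>)" "(r n - l) * Z \<omega>"]
        by (simp add: power_mult_distrib)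
      then show "ennreal (((\<Sum>i\<in>A. C n \<omega> $ i) / real n powr s - l * Z \<omega>)\<^sup>2) \<le>
          ennreal (2 * (r n)\<^sup>2) * ennreal ((scaled_mass n \<omega> - Z \<omega>)\<^sup>2) +
          ennreal (2 * (r n - l)\<^sup>2) * ennreal ((Z \<omega>)\<^sup>2)"
        by (simp add: ennreal_mult[symmetric] ennreal_plus[symmetric] ennreal_leI del: ennreal_plus)
    qed
    also have "\<dots> = ennreal (2 * (r n)\<^sup>2) * (\<integral>\<^sup>+\<omega>. ennreal ((scaled_mass n \<omega> - Z \<omega>)\<^sup>2) \<partial>M) +
        ennreal (2 * (r n - l)\<^sup>2) * (\<integral>\<^sup>+\<omega>. ennreal ((Z \<omega>)\<^sup>2) \<partial>M)"
      by (subst nn_integral_add) (auto simp: nn_integral_cmult)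
    also have "(\<integral>\<^sup>+\<omega>. ennreal ((Z \<omega>)\<^sup>2) \<partial>M) = ennreal B"
      unfolding B_def by (rule nn_integral_eq_integral[OF Z2]) simp
    also have "ennreal (2 * (r n)\<^sup>2) * (\<integral>\<^sup>+\<omega>. ennreal ((scaled_mass n \<omega> - Z \<omega>)\<^sup>2) \<partial>M) +
        ennreal (2 * (r n - l)\<^sup>2) * ennreal B \<le>
        ennreal (2 * (r n)\<^sup>2) * ennreal (s * x\<^sub>0 / growth s n) + ennreal (2 * (r n - l)\<^sup>2) * ennreal B"
      by (intro add_right_mono mult_left_mono scaled_mass_L2_bound[OF Z lim]) simp
    also have "\<dots> = ennreal (2 * (r n)\<^sup>2 * (s * x\<^sub>0 / growth s n) + 2 * (r n - l)\<^sup>2 * B)"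
    proof -
      have "0 \<le> B" by (simp add: B_def)
      moreover have "0 \<le> s * x\<^sub>0 / growth s n"
        using s_pos initial_mass_pos growth_pos[OF s_pos, of n] by simp
      ultimately show ?thesis
        by (intro ennreal_lincomb) auto
    qed
    finally show ?thesis .
  qed
  have inv: "(\<lambda>n. s * x\<^sub>0 / growth s n) \<longlonglongrightarrow> 0"
  proof -
    have "(\<lambda>n. s * x\<^sub>0 * real n powr (- s) / r n) \<longlonglongrightarrow> s * x\<^sub>0 * 0 / l"
      using l s_pos
      by (intro tendsto_intros r tendsto_neg_powr filterlim_real_sequentially) auto
    moreover have "\<forall>\<^sub>F n in sequentially. s * x\<^sub>0 * real n powr (- s) / r n = s * x\<^sub>0 / growth s n"
      using eventually_gt_at_top[of 0] by eventually_elim (simp add: r_def powr_minus divide_simps)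
    ultimately have "(\<lambda>n. s * x\<^sub>0 / growth s n) \<longlonglongrightarrow> s * x\<^sub>0 * 0 / l"
      by (rule Lim_transform_eventually)
    then show ?thesis by simp
  qed
  have "(\<lambda>n. 2 * (r n)\<^sup>2 * (s * x\<^sub>0 / growth s n) + 2 * (r n - l)\<^sup>2 * B) \<longlonglongrightarrow>
      2 * l\<^sup>2 * 0 + 2 * (l - l)\<^sup>2 * B"
    by (intro tendsto_intros r inv)
  from tendsto_ennrealI[OF this]
  have bound_lim: "(\<lambda>n. ennreal (2 * (r n)\<^sup>2 * (s * x\<^sub>0 / growth s n) + 2 * (r n - l)\<^sup>2 * B)) \<longlonglongrightarrow> 0"
    by simp
  have "(\<lambda>n. \<integral>\<^sup>+\<omega>. ennreal (((\<Sum>i\<in>A. C n \<omega> $ i) / real n powr s - l * Z \<omega>)\<^sup>2) \<partial>M) \<longlonglongrightarrow> 0"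
    by (rule tendsto_sandwich[OF _ always_eventually[OF allI[OF bound]] tendsto_const bound_lim]) simp
  moreover have "integrable M (\<lambda>\<omega>. (l * Z \<omega>)\<^sup>2)"
    using Z2 by (simp add: power_mult_distrib)
  ultimately have "tendsto_AE_L2 M (\<lambda>n \<omega>. (\<Sum>i\<in>A. C n \<omega> $ i) / real n powr s) (\<lambda>\<omega>. l * Z \<omega>)"
    unfolding tendsto_AE_L2_def using AE by simp
  then show ?thesis by blast
qed

end

section \<open>Approximation of characteristic functions\<close>

lemma norm_cis_diff_1: "norm (cis x - 1) \<le> \<bar>x\<bar>"
  using iexp_approx1[of x 0] by (simp add: cis_conv_exp)

lemma norm_cis_taylor2: "norm (cis x - (1 + \<i> * x - x\<^sup>2 / 2)) \<le> \<bar>x\<bar> ^ 3 / 6"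
  using iexp_approx1[of x 2]
  by (simp add: cis_conv_exp numeral_eq_Suc power_mult_distrib)

lemma exp_minus_taylor1:
  fixes y :: real assumes "0 \<le> y" shows "\<bar>exp (- y) - (1 - y)\<bar> \<le> y\<^sup>2"
proof -
  have "1 - y \<le> exp (- y)" using exp_ge_add_one_self[of "- y"] by simp
  moreover have "exp (- y) \<le> 1 - y + y\<^sup>2"
  proof -
    have "1 + y \<le> exp y" using exp_ge_add_one_self[of y] by simp
    then have "exp (- y) \<le> 1 / (1 + y)" using assms by (simp add: exp_minus field_simps)
    also have "\<dots> \<le> 1 - y + y\<^sup>2" using assms by (simp add: field_simps power2_eq_square)
    finally show ?thesis .
  qed
  ultimately show ?thesis by simp
qed

text \<open>
  The Taylor terms of \<open>cis\<close> of order \<open>0\<close>, \<open>1\<close> and \<open>2\<close> average to \<open>1\<close>, \<open>0\<close> and \<open>- v u\<^sup>2 / 2\<close>, and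
  \<open>1 - v u\<^sup>2 / 2\<close> is also the beginning of the normal characteristic function.
\<close>
lemma char_centred_taylor:
  fixes p z :: "'i \<Rightarrow> real"
  assumes "finite A" and p: "\<And>i. i \<in> A \<Longrightarrow> 0 \<le> p i" "sum p A = 1" and mean: "(\<Sum>i\<in>A. p i * z i) = 0"
  defines "v \<equiv> \<Sum>i\<in>A. p i * (z i)\<^sup>2"
  shows "norm ((\<Sum>i\<in>A. of_real (p i) * cis (u * z i)) - exp (- of_real (v * u\<^sup>2 / 2))) \<le>
    (\<Sum>i\<in>A. p i * \<bar>z i\<bar> ^ 3) * \<bar>u\<bar> ^ 3 + v\<^sup>2 * u ^ 4"
proof -
  let ?T = "\<lambda>i. 1 + \<i> * of_real (u * z i) - of_real ((u * z i)\<^sup>2 / 2) :: complex"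
  have "(\<Sum>i\<in>A. of_real (p i) * ?T i) =
      of_real (sum p A) + \<i> * of_real u * of_real (\<Sum>i\<in>A. p i * z i) - of_real (v * u\<^sup>2 / 2)"
    unfolding v_def
    by (simp add: sum.distrib sum_subtractf algebra_simps sum_distrib_left sum_divide_distrib power_mult_distrib)
  then have T: "(\<Sum>i\<in>A. of_real (p i) * ?T i) = of_real (1 - v * u\<^sup>2 / 2)"
    using p mean by simp
  have v: "0 \<le> v" unfolding v_def using p by (intro sum_nonneg) auto
  have "norm ((\<Sum>i\<in>A. of_real (p i) * cis (u * z i)) - (\<Sum>i\<in>A. of_real (p i) * ?T i)) =
      norm (\<Sum>i\<in>A. of_real (p i) * (cis (u * z i) - ?T i))"
    by (simp add: sum_subtractf right_diff_distrib)
  also have "\<dots> \<le> (\<Sum>i\<in>A. p i * (\<bar>u * z i\<bar> ^ 3 / 6))"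
  proof (rule sum_norm_le)
    fix i assume "i \<in> A"
    then have "\<bar>p i\<bar> * norm (cis (u * z i) - ?T i) \<le> p i * (\<bar>u * z i\<bar> ^ 3 / 6)"
      using p norm_cis_taylor2[of "u * z i"] by (simp only: abs_of_nonneg mult_left_mono)
    then show "norm (of_real (p i) * (cis (u * z i) - ?T i)) \<le> p i * (\<bar>u * z i\<bar> ^ 3 / 6)"
      by (simp only: norm_mult norm_of_real)
  qed
  also have "\<dots> \<le> (\<Sum>i\<in>A. p i * \<bar>u * z i\<bar> ^ 3)"
    using p by (intro sum_mono mult_left_mono) auto
  also have "\<dots> = (\<Sum>i\<in>A. p i * \<bar>z i\<bar> ^ 3) * \<bar>u\<bar> ^ 3"
    unfolding sum_distrib_right by (simp add: abs_mult power_mult_distrib mult_ac)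
  finally have 1: "norm ((\<Sum>i\<in>A. of_real (p i) * cis (u * z i)) - of_real (1 - v * u\<^sup>2 / 2)) \<le>
      (\<Sum>i\<in>A. p i * \<bar>z i\<bar> ^ 3) * \<bar>u\<bar> ^ 3" unfolding T .
  have "norm (of_real (1 - v * u\<^sup>2 / 2) - exp (- of_real (v * u\<^sup>2 / 2)) :: complex) =
      \<bar>exp (- (v * u\<^sup>2 / 2)) - (1 - v * u\<^sup>2 / 2)\<bar>"
    by (metis exp_of_real norm_minus_commute norm_of_real of_real_diff of_real_minus)
  also have "\<dots> \<le> (v * u\<^sup>2 / 2)\<^sup>2" using v by (intro exp_minus_taylor1) simp
  also have "\<dots> = v\<^sup>2 * u ^ 4 / 4" by (simp add: power_mult_distrib power_divide)
  also have "\<dots> \<le> v\<^sup>2 * u ^ 4" by simp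
  finally show ?thesis by (rule norm_diff_triangle_le[OF 1])
qed

lemma harm_le_1_plus_ln: "0 < n \<Longrightarrow> (\<Sum>j<n. 1 / real (Suc j)) \<le> 1 + ln (real n)"
proof (induction n rule: nat_induct_non_zero)
  case (Suc n)
  have "ln (real n / real (Suc n)) \<le> real n / real (Suc n) - 1"
    using Suc by (intro ln_le_minus_one) auto
  also have "real n / real (Suc n) - 1 = - (1 / real (Suc n))" by (simp add: field_simps)
  finally have "1 / real (Suc n) \<le> ln (real (Suc n)) - ln (real n)"
    using Suc.hyps by (simp add: ln_div)
  then show ?case using Suc.IH by simp
qed simp

section \<open>Characteristic functions of normal mixtures\<close>

context prob_space
begin

lemma real_distribution_normal_mixture:
  assumes [measurable]: "V \<in> borel_measurable M"
  shows "real_distribution (normal_mixture M V)"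
proof -
  interpret Z: real_distribution std_normal_distribution by (rule real_dist_normal_dist)
  interpret pair_prob_space M std_normal_distribution ..
  show ?thesis
    unfolding normal_mixture_def by (rule P.real_distribution_distr) measurable
qed

text \<open>
  Integrating first over the normal coordinate leaves the mean of the normal characteristic function
  at the random scale \<open>sqrt V\<close>.
\<close>
lemma char_normal_mixture:
  assumes [measurable]: "V \<in> borel_measurable M" and nonneg: "AE \<omega> in M. 0 \<le> V \<omega>"
  shows "char (normal_mixture M V) t = (\<integral>\<omega>. of_real (exp (- (t\<^sup>2 * V \<omega> / 2))) \<partial>M)"
proof -
  interpret Z: real_distribution std_normal_distribution by (rule real_dist_normal_dist)
  interpret pair_prob_space M std_normal_distribution ..
  have int: "integrable (M \<Otimes>\<^sub>M std_normal_distribution) (\<lambda>p. iexp (t * (sqrt (V (fst p)) * snd p)))"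
    by (rule P.integrable_const_bound[where B = 1]) auto
  have "char (normal_mixture M V) t =
      (\<integral>p. iexp (t * (sqrt (V (fst p)) * snd p)) \<partial>(M \<Otimes>\<^sub>M std_normal_distribution))"
    unfolding char_def normal_mixture_def by (subst integral_distr) (auto simp: case_prod_unfold)
  also have "\<dots> = (\<integral>\<omega>. (\<integral>z. iexp (t * (sqrt (V \<omega>) * z)) \<partial>std_normal_distribution) \<partial>M)"
    using integral_fst'[OF int] by simp
  also have "\<dots> = (\<integral>\<omega>. char std_normal_distribution (t * sqrt (V \<omega>)) \<partial>M)"
    unfolding char_def by (simp only: mult.assoc)
  also have "\<dots> = (\<integral>\<omega>. of_real (exp (- (t\<^sup>2 * V \<omega> / 2))) \<partial>M)"
  proof (rule integral_cong_AE)
    show "AE \<omega> in M. char std_normal_distribution (t * sqrt (V \<omega>)) = of_real (exp (- (t\<^sup>2 * V \<omega> / 2)))"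
      using nonneg
      by eventually_elim (simp only: char_std_normal_distribution power_mult_distrib real_sqrt_pow2 minus_divide_left)
  qed (simp_all add: char_std_normal_distribution)
  finally show ?thesis .
qed

end

section \<open>The central limit theorem with random variance\<close>

context rank_one_block_urn
begin

text \<open>
  The characteristic function of \<open>z\<close> evaluated at the colour of the next draw from \<open>A\<close>, given that \<open>A\<close> has
  been hit \<open>m\<close> times before.
\<close>
definition colour_char :: "('k \<Rightarrow> real) \<Rightarrow> real \<Rightarrow> nat \<Rightarrow> complex" where
  "colour_char z u m = (\<Sum>i\<in>A. of_real ((c\<^sub>0 $ i + s * \<nu> i * real m) / mass m) * cis (u * z i))"

text \<open>
  The characteristic function of a sum of independent variables, one for each of the first \<open>m\<close> hits.
\<close>
definition sum_char :: "('k \<Rightarrow> real) \<Rightarrow> real \<Rightarrow> nat \<Rightarrow> complex" where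
  "sum_char z u m = (\<Prod>j<m. colour_char z u j)"

lemma initial_nonneg: "0 \<le> c\<^sub>0 $ i"
  using prob_vector_initial by (simp add: prob_vector_def)

lemma norm_colour_char_le_1: "norm (colour_char z u m) \<le> 1"
proof -
  have "norm (colour_char z u m) \<le> (\<Sum>i\<in>A. (c\<^sub>0 $ i + s * \<nu> i * real m) / mass m)"
    unfolding colour_char_def
  proof (rule sum_norm_le)
    fix i assume "i \<in> A"
    then have "0 \<le> (c\<^sub>0 $ i + s * \<nu> i * real m) / mass m"
      using initial_nonneg \<nu>_nonneg s_pos mass_pos[of m]
      by (intro divide_nonneg_pos add_nonneg_nonneg mult_nonneg_nonneg) auto
    then show "norm (of_real ((c\<^sub>0 $ i + s * \<nu> i * real m) / mass m) * cis (u * z i))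
        \<le> (c\<^sub>0 $ i + s * \<nu> i * real m) / mass m"
      by (simp only: norm_mult norm_of_real norm_cis abs_of_nonneg)
  qed
  also have "\<dots> = 1"
    using mass_pos[of m] unfolding sum_divide_distrib[symmetric] sum_colour_weights by simp
  finally show ?thesis .
qed

lemma norm_sum_char_le_1: "norm (sum_char z u m) \<le> 1"
  unfolding sum_char_def prod_norm[symmetric]
  by (intro prod_le_1) (auto simp: norm_colour_char_le_1)

text \<open>
  The colour weights approach \<open>\<nu>\<close> at rate \<open>1 / m\<close>. As the differences of the weights add up to \<open>0\<close>, \<open>cis\<close>
  may be replaced by \<open>cis - 1\<close>, which yields the additional factor \<open>\<bar>u\<bar>\<close>; without it the errors
  would not vanish in the limit.
\<close>
lemma colour_char_close:
  fixes z :: "'k \<Rightarrow> real" and u :: real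
  defines "c \<equiv> (\<Sum>i\<in>A. \<bar>c\<^sub>0 $ i - \<nu> i * x\<^sub>0\<bar> * \<bar>z i\<bar>) / min x\<^sub>0 s"
  shows "norm (colour_char z u m - (\<Sum>i\<in>A. of_real (\<nu> i) * cis (u * z i))) \<le> c * \<bar>u\<bar> * (1 / real (Suc m))"
proof -
  let ?q = "\<lambda>i. (c\<^sub>0 $ i + s * \<nu> i * real m) / mass m"
  have diff: "?q i - \<nu> i = (c\<^sub>0 $ i - \<nu> i * x\<^sub>0) / mass m" for i
    using mass_pos[of m] by (simp add: field_simps) (simp add: mass_def algebra_simps)
  have "(\<Sum>i\<in>A. ?q i - \<nu> i) = 0"
    using mass_pos[of m] unfolding sum_subtractf sum_\<nu> sum_divide_distrib[symmetric] sum_colour_weights by simp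
  then have "(\<Sum>i\<in>A. complex_of_real (?q i - \<nu> i)) = 0"
    by (metis of_real_0 of_real_sum)
  then have "colour_char z u m - (\<Sum>i\<in>A. of_real (\<nu> i) * cis (u * z i)) =
      (\<Sum>i\<in>A. of_real (?q i - \<nu> i) * cis (u * z i)) - (\<Sum>i\<in>A. complex_of_real (?q i - \<nu> i))"
    unfolding colour_char_def by (simp add: sum_subtractf left_diff_distrib)
  also have "\<dots> = (\<Sum>i\<in>A. of_real (?q i - \<nu> i) * (cis (u * z i) - 1))"
    by (simp add: sum_subtractf right_diff_distrib)
  also have "norm \<dots> \<le> (\<Sum>i\<in>A. \<bar>c\<^sub>0 $ i - \<nu> i * x\<^sub>0\<bar> / mass m * (\<bar>u\<bar> * \<bar>z i\<bar>))"
  proof (rule sum_norm_le)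
    fix i
    have "norm (complex_of_real (?q i - \<nu> i) * (cis (u * z i) - 1)) = \<bar>?q i - \<nu> i\<bar> * norm (cis (u * z i) - 1)"
      by (simp only: norm_mult norm_of_real)
    also have "\<dots> \<le> \<bar>?q i - \<nu> i\<bar> * \<bar>u * z i\<bar>"
      by (intro mult_left_mono norm_cis_diff_1) simp
    finally show "norm (complex_of_real (?q i - \<nu> i) * (cis (u * z i) - 1)) \<le>
        \<bar>c\<^sub>0 $ i - \<nu> i * x\<^sub>0\<bar> / mass m * (\<bar>u\<bar> * \<bar>z i\<bar>)"
      unfolding diff using mass_pos[of m] by (simp add: abs_mult)
  qed
  also have "\<dots> = (\<Sum>i\<in>A. \<bar>c\<^sub>0 $ i - \<nu> i * x\<^sub>0\<bar> * \<bar>z i\<bar>) * \<bar>u\<bar> * (1 / mass m)"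
    unfolding sum_distrib_right by (simp add: mult_ac)
  also have "\<dots> \<le> (\<Sum>i\<in>A. \<bar>c\<^sub>0 $ i - \<nu> i * x\<^sub>0\<bar> * \<bar>z i\<bar>) * \<bar>u\<bar> * (1 / (min x\<^sub>0 s * real (Suc m)))"
  proof (intro mult_left_mono divide_left_mono)
    have "min x\<^sub>0 s * real (Suc m) = min x\<^sub>0 s + min x\<^sub>0 s * real m" by (simp add: algebra_simps)
    also have "\<dots> \<le> mass m" unfolding mass_def by (intro add_mono mult_right_mono) auto
    finally show "min x\<^sub>0 s * real (Suc m) \<le> mass m" .
    show "0 < mass m * (min x\<^sub>0 s * real (Suc m))"
      using mass_pos s_pos initial_mass_pos by (intro mult_pos_pos) auto
  qed (auto intro!: sum_nonneg mult_nonneg_nonneg)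
  finally show ?thesis by (simp add: c_def)
qed

text \<open>
  Given the times of the hits, the colours at the hits are independent, with laws that depend on the
  number of earlier hits only. The test function \<open>g\<close> carries the induction: one step of the urn
  replaces \<open>g\<close> by another function of the number of hits.
\<close>
lemma expectation_cis_sum:
  fixes z :: "'k \<Rightarrow> real" and g :: "nat \<Rightarrow> complex"
  assumes off: "\<And>i. i \<notin> A \<Longrightarrow> z i = 0"
  shows "(\<integral>\<omega>. cis (u * (\<Sum>i\<leftarrow>history n \<omega>. z i)) * g (N n \<omega>) \<partial>M) =
    (\<integral>\<omega>. sum_char z u (N n \<omega>) * g (N n \<omega>) \<partial>M)"
proof (induction n arbitrary: g)
  case 0
  then show ?case by (simp add: sum_char_def)
next
  case (Suc n)
  define g' where "g' m = of_real (mass m / real (Suc n)) * (colour_char z u m * g (Suc m)) +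
      of_real (1 - mass m / real (Suc n)) * g m" for m
  have step: "(\<Sum>i\<in>UNIV. (composition xs $ i / real (Suc n)) *\<^sub>R
      (cis (u * (\<Sum>i\<leftarrow>xs @ [i]. z i)) * g (hits (xs @ [i])))) =
      cis (u * (\<Sum>i\<leftarrow>xs. z i)) * g' (hits xs)" if "length xs = n" for xs
  proof -
    let ?e = "cis (u * (\<Sum>i\<leftarrow>xs. z i))"
    have "(\<Sum>i\<in>UNIV. (composition xs $ i / real (Suc n)) *\<^sub>R
        (cis (u * (\<Sum>i\<leftarrow>xs @ [i]. z i)) * g (hits (xs @ [i])))) =
        (\<Sum>i\<in>-A. of_real (composition xs $ i / real (Suc n)) * (?e * g (hits xs))) +
        (\<Sum>i\<in>A. of_real (composition xs $ i / real (Suc n)) * (?e * cis (u * z i) * g (Suc (hits xs))))"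
      by (subst sum.subset_diff[of A UNIV])
        (auto simp: Compl_eq_Diff_UNIV off scaleR_conv_of_real distrib_left cis_mult[symmetric]
          intro!: arg_cong2[where f = "(+)"] sum.cong)
    also have "(\<Sum>i\<in>-A. of_real (composition xs $ i / real (Suc n)) * (?e * g (hits xs))) =
        of_real ((\<Sum>i\<in>-A. composition xs $ i) / real (Suc n)) * (?e * g (hits xs))"
      by (simp only: sum_distrib_right[symmetric] sum_divide_distrib of_real_sum)
    also have "(\<Sum>i\<in>-A. composition xs $ i) / real (Suc n) = 1 - mass (hits xs) / real (Suc n)"
      by (simp only: sum_composition_off_block that diff_divide_distrib) simp
    also have "(\<Sum>i\<in>A. of_real (composition xs $ i / real (Suc n)) * (?e * cis (u * z i) * g (Suc (hits xs)))) =
        of_real (mass (hits xs) / real (Suc n)) * colour_char z u (hits xs) * ?e * g (Suc (hits xs))"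
      using mass_pos[of "hits xs"]
      unfolding colour_char_def sum_distrib_left sum_distrib_right
      by (intro sum.cong refl) (simp add: composition_in_block del: of_nat_Suc)
    finally show ?thesis by (simp add: g'_def algebra_simps)
  qed
  have "(\<integral>\<omega>. cis (u * (\<Sum>i\<leftarrow>history (Suc n) \<omega>. z i)) * g (N (Suc n) \<omega>) \<partial>M) =
      (\<integral>\<omega>. cis (u * (\<Sum>i\<leftarrow>history n \<omega>. z i)) * g' (N n \<omega>) \<partial>M)"
    using expectation_history_Suc[of "\<lambda>xs. cis (u * (\<Sum>i\<leftarrow>xs. z i)) * g (hits xs)" n]
    by (simp only: step length_history)
  also have "\<dots> = (\<integral>\<omega>. sum_char z u (N n \<omega>) * g' (N n \<omega>) \<partial>M)" by (rule Suc.IH)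
  also have "\<dots> = (\<integral>\<omega>. sum_char z u (N (Suc n) \<omega>) * g (N (Suc n) \<omega>) \<partial>M)"
  proof -
    have "sum_char z u m * g' m = (mass m / real (Suc n)) *\<^sub>R (sum_char z u (Suc m) * g (Suc m)) +
        (1 - mass m / real (Suc n)) *\<^sub>R (sum_char z u m * g m)" for m
      by (simp add: g'_def sum_char_def scaleR_conv_of_real algebra_simps)
    then show ?thesis
      using expectation_hits_Suc[of "\<lambda>xs m. sum_char z u m * g m" n] by simp
  qed
  finally show ?case .
qed

text \<open>
  With \<open>u = t / n powr (s / 2)\<close> there are \<open>k n = O(n powr s)\<close> factors. Comparing each of them with the normal
  characteristic function costs \<open>O(\<bar>u\<bar> / (j + 1))\<close> for the deviation of the weights from \<open>\<nu>\<close>, in total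
  \<open>O(\<bar>u\<bar> ln n)\<close> as \<open>k n \<le> n\<close>, and \<open>O(\<bar>u\<bar> ^ 3)\<close> for the Taylor remainder, in total \<open>O(n powr (- s / 2))\<close>.
\<close>
lemma sum_char_gaussian_limit:
  fixes z :: "'k \<Rightarrow> real" and k :: "nat \<Rightarrow> nat"
  assumes mean: "(\<Sum>i\<in>A. \<nu> i * z i) = 0"
    and k_le: "\<And>n. k n \<le> n" and k_lim: "(\<lambda>n. real (k n) / real n powr s) \<longlonglongrightarrow> y"
  defines "v \<equiv> \<Sum>i\<in>A. \<nu> i * (z i)\<^sup>2"
  shows "(\<lambda>n. sum_char z (t / real n powr (s / 2)) (k n)) \<longlonglongrightarrow> of_real (exp (- (t\<^sup>2 * (v * y) / 2)))"
proof -
  define c where "c = (\<Sum>i\<in>A. \<bar>c\<^sub>0 $ i - \<nu> i * x\<^sub>0\<bar> * \<bar>z i\<bar>) / min x\<^sub>0 s"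
  define d where "d = (\<Sum>i\<in>A. \<nu> i * \<bar>z i\<bar> ^ 3)"
  define u where "u n = t / real n powr (s / 2)" for n
  define e where "e u = exp (- of_real (v * u\<^sup>2 / 2) :: complex)" for u
  have c: "0 \<le> c"
    unfolding c_def using s_pos initial_mass_pos by (intro divide_nonneg_pos sum_nonneg) auto
  have v: "0 \<le> v" unfolding v_def using \<nu>_nonneg by (intro sum_nonneg) auto
  have e: "norm (e u) \<le> 1" for u unfolding e_def using v by simp
  have colour: "norm (colour_char z u j - e u) \<le> c * \<bar>u\<bar> * (1 / real (Suc j)) + (d * \<bar>u\<bar> ^ 3 + v\<^sup>2 * u ^ 4)" for u j
  proof -
    have "norm ((\<Sum>i\<in>A. of_real (\<nu> i) * cis (u * z i)) - e u) \<le> d * \<bar>u\<bar> ^ 3 + v\<^sup>2 * u ^ 4"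
      unfolding d_def v_def e_def using \<nu>_nonneg sum_\<nu> mean
      by (intro char_centred_taylor) auto
    then show ?thesis
      using colour_char_close[of z u j] unfolding c_def[symmetric]
      by (rule norm_diff_triangle_le[rotated])
  qed
  have bound: "norm (sum_char z (u n) (k n) - e (u n) ^ k n) \<le>
      c * (\<bar>t\<bar> * ((1 + ln (real n)) / real n powr (s / 2))) +
      real (k n) / real n powr s * (d * \<bar>t\<bar> ^ 3 * real n powr (- (s / 2)) + v\<^sup>2 * t ^ 4 * real n powr (- s))"
    if "0 < n" for n
  proof -
    have "norm (sum_char z (u n) (k n) - (\<Prod>j<k n. e (u n))) \<le> (\<Sum>j<k n. norm (colour_char z (u n) j - e (u n)))"
      unfolding sum_char_def by (intro norm_prod_diff norm_colour_char_le_1 e)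
    also have "\<dots> \<le> (\<Sum>j<k n. c * \<bar>u n\<bar> * (1 / real (Suc j)) + (d * \<bar>u n\<bar> ^ 3 + v\<^sup>2 * u n ^ 4))"
      by (intro sum_mono colour)
    also have "\<dots> = c * \<bar>u n\<bar> * (\<Sum>j<k n. 1 / real (Suc j)) + real (k n) * (d * \<bar>u n\<bar> ^ 3 + v\<^sup>2 * u n ^ 4)"
      by (simp add: sum.distrib sum_distrib_left)
    also have "\<dots> \<le> c * \<bar>u n\<bar> * (1 + ln (real n)) + real (k n) * (d * \<bar>u n\<bar> ^ 3 + v\<^sup>2 * u n ^ 4)"
    proof -
      have "(\<Sum>j<k n. 1 / real (Suc j)) \<le> (\<Sum>j<n. 1 / real (Suc j))"
        using k_le[of n] by (intro sum_mono2) auto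
      also have "\<dots> \<le> 1 + ln (real n)" using that by (rule harm_le_1_plus_ln)
      finally show ?thesis using c by (intro add_right_mono mult_left_mono) auto
    qed
    also have "\<bar>u n\<bar> ^ 3 = \<bar>t\<bar> ^ 3 * real n powr (- (s / 2)) / real n powr s"
    proof -
      have "(real n powr (s / 2)) ^ 3 = real n powr (s / 2) * real n powr s"
        using that by (simp add: powr_power powr_add[symmetric])
      then show ?thesis
        by (simp add: u_def power_divide powr_minus field_simps)
    qed
    also have "u n ^ 4 = t ^ 4 * real n powr (- s) / real n powr s"
    proof -
      have "(real n powr (s / 2)) ^ 4 = real n powr s * real n powr s"
        using that by (simp add: powr_power powr_add[symmetric])
      then show ?thesis
        by (simp add: u_def power_divide powr_minus field_simps)
    qed
    finally have "norm (sum_char z (u n) (k n) - e (u n) ^ k n) \<le> c * \<bar>u n\<bar> * (1 + ln (real n)) +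
        real (k n) * (d * (\<bar>t\<bar> ^ 3 * real n powr (- (s / 2)) / real n powr s) +
          v\<^sup>2 * (t ^ 4 * real n powr (- s) / real n powr s))"
      by simp
    moreover have "c * \<bar>u n\<bar> * (1 + ln (real n)) = c * (\<bar>t\<bar> * ((1 + ln (real n)) / real n powr (s / 2)))"
      by (simp add: u_def)
    moreover have "real (k n) * (d * (\<bar>t\<bar> ^ 3 * real n powr (- (s / 2)) / real n powr s) +
          v\<^sup>2 * (t ^ 4 * real n powr (- s) / real n powr s)) =
        real (k n) / real n powr s * (d * \<bar>t\<bar> ^ 3 * real n powr (- (s / 2)) + v\<^sup>2 * t ^ 4 * real n powr (- s))"
      by (simp add: add_divide_distrib distrib_left mult_ac)
    ultimately show ?thesis by simp
  qed
  have "(\<lambda>n. (1 + ln (real n)) / real n powr (s / 2)) \<longlonglongrightarrow> 0"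
    using s_pos by real_asymp
  then have "(\<lambda>n. c * (\<bar>t\<bar> * ((1 + ln (real n)) / real n powr (s / 2))) +
      real (k n) / real n powr s * (d * \<bar>t\<bar> ^ 3 * real n powr (- (s / 2)) + v\<^sup>2 * t ^ 4 * real n powr (- s)))
      \<longlonglongrightarrow> c * (\<bar>t\<bar> * 0) + y * (d * \<bar>t\<bar> ^ 3 * 0 + v\<^sup>2 * t ^ 4 * 0)"
    using s_pos by (intro tendsto_intros k_lim tendsto_neg_powr filterlim_real_sequentially) auto
  then have bound_lim: "(\<lambda>n. c * (\<bar>t\<bar> * ((1 + ln (real n)) / real n powr (s / 2))) +
      real (k n) / real n powr s * (d * \<bar>t\<bar> ^ 3 * real n powr (- (s / 2)) + v\<^sup>2 * t ^ 4 * real n powr (- s)))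
      \<longlonglongrightarrow> 0"
    by simp
  have null: "(\<lambda>n. sum_char z (u n) (k n) - e (u n) ^ k n) \<longlonglongrightarrow> 0"
  proof (rule Lim_null_comparison[OF _ bound_lim])
    show "\<forall>\<^sub>F n in sequentially. norm (sum_char z (u n) (k n) - e (u n) ^ k n) \<le>
        c * (\<bar>t\<bar> * ((1 + ln (real n)) / real n powr (s / 2))) +
        real (k n) / real n powr s * (d * \<bar>t\<bar> ^ 3 * real n powr (- (s / 2)) + v\<^sup>2 * t ^ 4 * real n powr (- s))"
      using eventually_gt_at_top[of 0] by eventually_elim (rule bound)
  qed
  have "(\<lambda>n. complex_of_real (exp (- (t\<^sup>2 * (v * (real (k n) / real n powr s)) / 2)))) \<longlonglongrightarrow>
      of_real (exp (- (t\<^sup>2 * (v * y) / 2)))"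
    by (intro tendsto_intros k_lim) auto
  moreover have "\<forall>\<^sub>F n in sequentially.
      complex_of_real (exp (- (t\<^sup>2 * (v * (real (k n) / real n powr s)) / 2))) = e (u n) ^ k n"
    using eventually_gt_at_top[of 0]
  proof eventually_elim
    case (elim n)
    have "(u n)\<^sup>2 = t\<^sup>2 / real n powr s"
      using elim by (simp add: u_def power_divide powr_power)
    then have "e (u n) ^ k n = exp (of_nat (k n) * (- of_real (v * (t\<^sup>2 / real n powr s) / 2)))"
      by (simp only: e_def exp_of_nat_mult)
    also have "\<dots> = of_real (exp (- (t\<^sup>2 * (v * (real (k n) / real n powr s)) / 2)))"
      unfolding exp_of_real[symmetric] by (rule arg_cong[where f = exp]) simp
    finally show ?case by simp
  qed
  ultimately have "(\<lambda>n. e (u n) ^ k n) \<longlonglongrightarrow> of_real (exp (- (t\<^sup>2 * (v * y) / 2)))"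
    by (rule Lim_transform_eventually)
  from tendsto_add[OF null this] show ?thesis by (simp add: u_def)
qed

lemma composition_inner: "composition xs \<bullet> w = c\<^sub>0 \<bullet> w + (\<Sum>i\<leftarrow>xs. (R *v w) $ i)"
proof (induction xs rule: rev_induct)
  case (snoc i xs)
  have "row i R \<bullet> w = (R *v w) $ i"
    by (simp add: matrix_vector_mult_def row_def inner_vec_def)
  then show ?case using snoc by (simp add: inner_add_left)
qed simp

text \<open>
  In the direction \<open>w\<close> only the hits of \<open>A\<close> move the urn, and under \<open>\<nu>\<close> they move it by \<open>0\<close> in the mean. The
  randomness of the limit variance is that of the number of hits, whose order \<open>n powr s\<close> and limit
  \<open>U / s\<close> come from the mass; conditionally on that number the fluctuations are
  asymptotically Gaussian.
\<close>
theorem weak_conv_normal_mixture: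
  fixes w :: "real ^ 'k"
  assumes off: "\<And>i. i \<notin> A \<Longrightarrow> (R *v w) $ i = 0"
    and mean: "(\<Sum>i\<in>A. \<nu> i * (R *v w) $ i) = 0"
    and U: "tendsto_AE_L2 M (\<lambda>n \<omega>. (\<Sum>i\<in>A. C n \<omega> $ i) / real n powr s) U"
  shows "weak_conv_m (\<lambda>n. distr M borel (\<lambda>\<omega>. (C n \<omega> \<bullet> w) / real n powr (s / 2)))
    (normal_mixture M (\<lambda>\<omega>. (\<Sum>i\<in>A. \<nu> i * ((R *v w) $ i)\<^sup>2) * U \<omega> / s))"
proof -
  define z where "z i = (R *v w) $ i" for i
  define v where "v = (\<Sum>i\<in>A. \<nu> i * (z i)\<^sup>2)"
  define V where "V \<omega> = v * U \<omega> / s" for \<omega>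
  define X where "X n \<omega> = (C n \<omega> \<bullet> w) / real n powr (s / 2)" for n \<omega>
  have [measurable]: "U \<in> borel_measurable M"
    and lim: "AE \<omega> in M. (\<lambda>n. (\<Sum>i\<in>A. C n \<omega> $ i) / real n powr s) \<longlonglongrightarrow> U \<omega>"
    using U by (auto simp: tendsto_AE_L2_def)
  have [measurable]: "V \<in> borel_measurable M" unfolding V_def by measurable
  have v: "0 \<le> v" unfolding v_def using \<nu>_nonneg by (intro sum_nonneg) auto
  have mass_lim: "AE \<omega> in M. (\<lambda>n. mass (N n \<omega>) / real n powr s) \<longlonglongrightarrow> U \<omega>"
    using lim AE_space by eventually_elim (simp add: mass_eq_sum_C)
  have V_nonneg: "AE \<omega> in M. 0 \<le> V \<omega>"
    using mass_lim
  proof eventually_elim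
    case (elim \<omega>)
    then have "0 \<le> U \<omega>"
      by (rule LIMSEQ_le_const) (auto intro!: exI[of _ 0] divide_nonneg_nonneg simp: less_imp_le[OF mass_pos])
    then show ?case using v s_pos by (simp add: V_def)
  qed
  have N_lim: "AE \<omega> in M. (\<lambda>n. real (N n \<omega>) / real n powr s) \<longlonglongrightarrow> U \<omega> / s"
    using mass_lim
  proof eventually_elim
    case (elim \<omega>)
    have "(\<lambda>n. (mass (N n \<omega>) / real n powr s - x\<^sub>0 * real n powr (- s)) / s) \<longlonglongrightarrow> (U \<omega> - x\<^sub>0 * 0) / s"
      using s_pos by (intro tendsto_intros elim tendsto_neg_powr filterlim_real_sequentially) auto
    moreover have "(mass (N n \<omega>) / real n powr s - x\<^sub>0 * real n powr (- s)) / s = real (N n \<omega>) / real n powr s" for n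
      using s_pos by (simp add: mass_def powr_minus_divide diff_divide_distrib[symmetric])
    ultimately show ?case by simp
  qed
  have X_eq: "X n \<omega> = (c\<^sub>0 \<bullet> w + (\<Sum>i\<leftarrow>history n \<omega>. z i)) / real n powr (s / 2)" if "\<omega> \<in> space M" for n \<omega>
    using that by (simp add: X_def C_eq_composition composition_inner z_def)
  have X [measurable]: "X n \<in> borel_measurable M" for n
  proof -
    have "integrable M (\<lambda>\<omega>. (\<lambda>xs. (c\<^sub>0 \<bullet> w + (\<Sum>i\<leftarrow>xs. z i)) / real n powr (s / 2)) (history n \<omega>))"
      by (rule expectation_history(1))
    then have "(\<lambda>\<omega>. (c\<^sub>0 \<bullet> w + (\<Sum>i\<leftarrow>history n \<omega>. z i)) / real n powr (s / 2)) \<in> borel_measurable M"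
      by (rule borel_measurable_integrable)
    then show ?thesis using X_eq by (simp cong: measurable_cong)
  qed
  have "weak_conv_m (\<lambda>n. distr M borel (X n)) (normal_mixture M V)"
  proof (rule levy_continuity)
    show "real_distribution (distr M borel (X n))" for n
      by (rule real_distribution_distr) (rule X)
    show "real_distribution (normal_mixture M V)"
      by (rule real_distribution_normal_mixture) measurable
    fix t :: real
    define u where "u n = t / real n powr (s / 2)" for n
    have char: "char (distr M borel (X n)) t =
        cis (u n * (c\<^sub>0 \<bullet> w)) * (\<integral>\<omega>. sum_char z (u n) (N n \<omega>) \<partial>M)" for n
    proof -
      have "char (distr M borel (X n)) t = (\<integral>\<omega>. cis (t * X n \<omega>) \<partial>M)"
        unfolding char_def by (subst integral_distr) (auto simp: cis_conv_exp)
      also have "\<dots> = (\<integral>\<omega>. cis (u n * (c\<^sub>0 \<bullet> w)) * (cis (u n * (\<Sum>i\<leftarrow>history n \<omega>. z i)) * 1) \<partial>M)"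
        by (rule Bochner_Integration.integral_cong)
          (simp_all add: X_eq cis_mult u_def add_divide_distrib distrib_left)
      also have "\<dots> = cis (u n * (c\<^sub>0 \<bullet> w)) * (\<integral>\<omega>. cis (u n * (\<Sum>i\<leftarrow>history n \<omega>. z i)) * 1 \<partial>M)"
        by (rule integral_mult_right_zero)
      also have "(\<integral>\<omega>. cis (u n * (\<Sum>i\<leftarrow>history n \<omega>. z i)) * 1 \<partial>M) = (\<integral>\<omega>. sum_char z (u n) (N n \<omega>) * 1 \<partial>M)"
        by (rule expectation_cis_sum) (simp add: z_def off)
      finally show ?thesis by simp
    qed
    have "(\<lambda>n. \<integral>\<omega>. sum_char z (u n) (N n \<omega>) \<partial>M) \<longlonglongrightarrow> (\<integral>\<omega>. of_real (exp (- (t\<^sup>2 * V \<omega> / 2))) \<partial>M)"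
    proof (rule integral_dominated_convergence[where w = "\<lambda>_. 1"])
      show "AE \<omega> in M. (\<lambda>n. sum_char z (u n) (N n \<omega>)) \<longlonglongrightarrow> of_real (exp (- (t\<^sup>2 * V \<omega> / 2)))"
        using N_lim
      proof eventually_elim
        case (elim \<omega>)
        have "(\<Sum>i\<in>A. \<nu> i * z i) = 0" using mean by (simp add: z_def)
        from sum_char_gaussian_limit[OF this N_le elim, of t]
        show ?case by (simp add: u_def V_def v_def)
      qed
      show "(\<lambda>\<omega>. sum_char z (u n) (N n \<omega>)) \<in> borel_measurable M" for n
        by (rule borel_measurable_integrable) (rule integrable_N)
      show "AE \<omega> in M. norm (sum_char z (u n) (N n \<omega>)) \<le> 1" for n
        by (simp add: norm_sum_char_le_1)
    qed simp_all
    moreover have "(\<lambda>n. cis (u n * (c\<^sub>0 \<bullet> w))) \<longlonglongrightarrow> 1"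
    proof -
      have "(\<lambda>n. t * real n powr (- (s / 2)) * (c\<^sub>0 \<bullet> w)) \<longlonglongrightarrow> t * 0 * (c\<^sub>0 \<bullet> w)"
        using s_pos by (intro tendsto_intros tendsto_neg_powr filterlim_real_sequentially) auto
      then have "(\<lambda>n. u n * (c\<^sub>0 \<bullet> w)) \<longlonglongrightarrow> 0"
        by (simp add: u_def powr_minus_divide)
      then have "(\<lambda>n. cis (u n * (c\<^sub>0 \<bullet> w))) \<longlonglongrightarrow> cis 0"
        by (intro tendsto_intros)
      then show ?thesis by simp
    qed
    ultimately show "(\<lambda>n. char (distr M borel (X n)) t) \<longlonglongrightarrow> char (normal_mixture M V) t"
      unfolding char char_normal_mixture[OF \<open>V \<in> borel_measurable M\<close> V_nonneg]
      using tendsto_mult[of "\<lambda>n. cis (u n * (c\<^sub>0 \<bullet> w))" 1 sequentially] by fastforce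
  qed
  then show ?thesis by (simp add: X_def[abs_def] V_def[abs_def] v_def z_def)
qed

end

section \<open>The four-colour urn\<close>

text \<open>
  Each row of \<open>Q\<close> is a probability vector annihilating \<open>\<xi>\<close>. As \<open>\<xi>\<close> is not constant, the two conditions
  determine the row, so the rows coincide, and a stationary distribution equals the common row.
\<close>
lemma stochastic_singular_2x2_rows_stationary:
  fixes Q :: "real ^ 2 ^ 2"
  assumes "stochastic Q" "stationary Q p" "\<xi> \<noteq> 0" "Q *v \<xi> = 0"
  shows "Q $ i $ j = p $ j" and "p \<bullet> \<xi> = 0"
proof -
  have sum: "Q $ i $ 1 + Q $ i $ 2 = 1" for i
    using assms(1) by (simp add: stochastic_def prob_vector_def row_def sum_2)
  have ker: "Q $ i $ 1 * \<xi> $ 1 + Q $ i $ 2 * \<xi> $ 2 = 0" for i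
    using arg_cong[OF assms(4), of "\<lambda>x. x $ i"] by (simp add: matrix_vector_mult_def sum_2)
  have eq: "Q $ i $ 1 * (\<xi> $ 1 - \<xi> $ 2) = - \<xi> $ 2" for i
  proof -
    have "Q $ i $ 2 = 1 - Q $ i $ 1" using sum[of i] by simp
    then show ?thesis using ker[of i] by (simp only:) (simp add: algebra_simps)
  qed
  have "\<xi> $ 1 \<noteq> \<xi> $ 2"
  proof
    assume *: "\<xi> $ 1 = \<xi> $ 2"
    then have "\<xi> $ 2 = 0" using eq[of 1] by simp
    then show False using * assms(3) by (simp add: vec_eq_iff forall_2)
  qed
  then have q1: "Q $ 1 $ 1 = Q $ 2 $ 1"
    using eq[of 1] eq[of 2] by (metis mult_cancel_right right_minus_eq)
  then have q2: "Q $ 1 $ 2 = Q $ 2 $ 2" using sum[of 1] sum[of 2] by simp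
  have p1: "p $ 1 + p $ 2 = 1"
    using assms(2) by (simp add: stationary_def prob_vector_def sum_2)
  have pj: "p $ k = Q $ 1 $ k" for k
  proof -
    have "p $ k = (p v* Q) $ k" using assms(2) by (simp add: stationary_def)
    also have "\<dots> = p $ 1 * Q $ 1 $ k + p $ 2 * Q $ 2 $ k"
      by (simp add: vector_matrix_mult_def sum_2 mult.commute)
    also have "\<dots> = Q $ 1 $ k * (p $ 1 + p $ 2)"
      using q1 q2 exhaust_2[of k] by (auto simp: algebra_simps)
    finally show ?thesis by (simp add: p1)
  qed
  then show "Q $ i $ j = p $ j"
    using q1 q2 exhaust_2[of i] exhaust_2[of j] by auto
  show "p \<bullet> \<xi> = 0"
    using ker[of 1] pj by (simp add: inner_vec_def sum_2)
qed

theorem proposition4p5: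
  fixes M :: "'a measure" and draw :: "nat \<Rightarrow> 'a \<Rightarrow> 4" and C :: "nat \<Rightarrow> 'a \<Rightarrow> real ^ 4"
    and c\<^sub>0 t\<^sub>3 :: "real ^ 4" and R T J :: "real ^ 4 ^ 4" and P Q E :: "real ^ 2 ^ 2"
    and \<pi>\<^sub>Q \<xi> :: "real ^ 2" and s lam \<beta> :: real
  assumes "urn_process M R c\<^sub>0 draw C"
    and "R = block_mat (s *\<^sub>R Q) E 0 P"
    and "0 < s" "s < 1"
    and "stochastic P" "irreducible_mat P" "stochastic Q" "irreducible_mat Q"
    and "stationary Q \<pi>\<^sub>Q"
    and "eigenvalues Q = {lam, 1}" "\<bar>lam\<bar> < 1"
    and "eigenvalues P = {\<beta>, 1}" "\<bar>\<beta>\<bar> < 1"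
    and "c\<^sub>0 $ 1 + c\<^sub>0 $ 2 > 0"
    and "\<not> diagonalizable R"
    and "repeated_eigenvalue R 0"
    and "eigenvector Q lam \<xi>"
    and "invertible T" "R ** T = T ** J"
    and "column 1 T = vector [1, 1, 0, 0]"
    and "column 2 T = vector [\<xi> $ 1, \<xi> $ 2, 0, 0]"
    and "column 3 T = t\<^sub>3"
    and "column 4 T = vector [1, 1, 1, 1]"
    and "J = vector
      [vector [s, 0, 0, 0],
       vector [0, 0, 1, 0],
       vector [0, 0, 0, 0],
       vector [0, 0, 0, 1]]"
  shows "(\<exists>U. tendsto_AE_L2 M (\<lambda>n \<omega>. (C n \<omega> $ 1 + C n \<omega> $ 2) / real n powr s) U) \<and>
    (\<forall>U. tendsto_AE_L2 M (\<lambda>n \<omega>. (C n \<omega> $ 1 + C n \<omega> $ 2) / real n powr s) U \<longrightarrow>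
      weak_conv_m (\<lambda>n. distr M borel (\<lambda>\<omega>. (C n \<omega> \<bullet> t\<^sub>3) / real n powr (s / 2)))
        (normal_mixture M (\<lambda>\<omega>. (\<pi>\<^sub>Q \<bullet> (\<chi> i. (\<xi> $ i)\<^sup>2)) * U \<omega> / s)))"
proof -
  interpret urn_process M R c\<^sub>0 draw C by fact
  have J: "column 2 J = 0" "column 3 J = axis 2 1"
    unfolding assms(24) by (simp_all add: vec_eq_iff forall_4 column_def vector_4 axis_def)
  have RT: "R *v column j T = T *v column j J" for j
  proof -
    have "column j (X ** Y) = X *v column j Y" for X Y :: "real ^ 4 ^ 4"
      by (simp add: vec_eq_iff column_def matrix_matrix_mult_def matrix_vector_mult_def)
    then show ?thesis using assms(19) by metis
  qed
  have R2: "R *v vector [\<xi> $ 1, \<xi> $ 2, 0, 0] = 0"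
    using RT[of 2] by (simp add: J assms(21))
  have R3: "R *v t\<^sub>3 = vector [\<xi> $ 1, \<xi> $ 2, 0, 0]"
    using RT[of 3] by (simp add: J assms(21,22) matrix_vector_mult_basis)
  have Rrows: "R $ i $ 1 = (if i = 1 then s * Q $ 1 $ 1 else if i = 2 then s * Q $ 2 $ 1 else 0)"
    "R $ i $ 2 = (if i = 1 then s * Q $ 1 $ 2 else if i = 2 then s * Q $ 2 $ 2 else 0)" for i
    using exhaust_4[of i] unfolding assms(2) block_mat_def by (auto simp: vector_4)
  \<comment> \<open>The second column of \<open>J\<close> vanishes, hence \<open>R t\<^sub>2 = 0\<close>; on the block \<open>R\<close> is \<open>s Q\<close>.\<close>
  have "Q *v \<xi> = 0"
  proof -
    have "s * (Q $ 1 $ 1 * \<xi> $ 1 + Q $ 1 $ 2 * \<xi> $ 2) = 0" "s * (Q $ 2 $ 1 * \<xi> $ 1 + Q $ 2 $ 2 * \<xi> $ 2) = 0"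
      using arg_cong[OF R2, of "\<lambda>x. x $ 1"] arg_cong[OF R2, of "\<lambda>x. x $ 2"]
      by (simp_all add: matrix_vector_mult_def sum_4 vector_4 Rrows algebra_simps)
    then show ?thesis
      using assms(3) by (simp add: vec_eq_iff forall_2 matrix_vector_mult_def sum_2)
  qed
  moreover have "\<xi> \<noteq> 0" using assms(17) by (simp add: eigenvector_def)
  ultimately have Q: "Q $ i $ j = \<pi>\<^sub>Q $ j" and centred: "\<pi>\<^sub>Q \<bullet> \<xi> = 0" for i j
    using stochastic_singular_2x2_rows_stationary[OF assms(7,9)] by blast+
  \<comment> \<open>Only the values at the colours \<open>1\<close> and \<open>2\<close> matter.\<close>
  define \<nu> :: "4 \<Rightarrow> real" where "\<nu> j = (if j = 1 then \<pi>\<^sub>Q $ 1 else \<pi>\<^sub>Q $ 2)" for j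
  have prob: "0 \<le> \<pi>\<^sub>Q $ j" "\<pi>\<^sub>Q $ 1 + \<pi>\<^sub>Q $ 2 = 1" for j
    using assms(9) by (simp_all add: stationary_def prob_vector_def sum_2)
  interpret rank_one_block_urn M R c\<^sub>0 draw C "{1, 2}" s \<nu>
  proof unfold_locales
    show "R $ i $ j = s * \<nu> j" if "i \<in> {1, 2}" "j \<in> {1, 2}" for i j
      using that by (auto simp: Rrows Q \<nu>_def)
    show "R $ i $ j = 0" if "i \<notin> {1, 2}" "j \<in> {1, 2}" for i j
      using that by (auto simp: Rrows)
  qed (use assms(3,14) prob in \<open>auto simp: \<nu>_def\<close>)
  have off: "(R *v t\<^sub>3) $ i = 0" if "i \<notin> {1, 2}" for i
    using that exhaust_4[of i] by (auto simp: R3 vector_4)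
  have mean: "(\<Sum>i\<in>{1, 2}. \<nu> i * (R *v t\<^sub>3) $ i) = 0"
    using centred by (simp add: R3 vector_4 \<nu>_def inner_vec_def sum_2)
  have var: "(\<Sum>i\<in>{1, 2}. \<nu> i * ((R *v t\<^sub>3) $ i)\<^sup>2) = \<pi>\<^sub>Q \<bullet> (\<chi> i. (\<xi> $ i)\<^sup>2)"
    by (simp add: R3 vector_4 \<nu>_def inner_vec_def sum_2)
  have sum12: "(\<Sum>i\<in>{1, 2}. x $ i) = x $ 1 + x $ 2" for x :: "real ^ 4"
    by simp
  show ?thesis
    using mass_tendsto_AE_L2 weak_conv_normal_mixture[OF off mean]
    unfolding sum12 var by blast
qed

end
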